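(* Let $p\in[0,1)$ and let $\phi:\mathbb C\to\mathbb C$ be an entire function. Let $\mathcal X$ be either $\mathcal{CA}_p$ or $\mathcal{CA}_{0,p}$. Then the superposition operator $\mathsf S^\phi(f)=\phi\circ f$ is bounded on $\mathcal X$ if and only if there exist $a,b\in\mathbb C$ such that $\phi(z)=az+b$ for all $z\in\mathbb C$.
   Context: $\mathbb D$ is the open unit disk, $\mathbb T$ the unit circle, $|d\xi|=d\theta$ for $\xi=e^{i\theta}$. For an arc $I\subseteq\mathbb T$, $|I|=(2\pi)^{-1}\int_I|d\xi|$ and $f_I=(2\pi|I|)^{-1}\int_I f(\xi)|d\xi|$. $\mathcal{CA}_p$ is the Banach space of all functions $f$ in the Hardy space $\mathcal H^2$ of $\mathbb D$ (identified with their radial boundary values on $\mathbb T$) with $\|f\|_{\mathcal{CA}_p,*}=\sup_{I\subseteq\mathbb T}\left(|I|^{-p}\int_I|f(\xi)-f_I|^2|d\xi|\right)^{1/2}<\infty$ (supremum over all sub-arcs), normed by $\|f\|_{\mathcal{CA}_p}=|f(0)|+\|f\|_{\mathcal{CA}_p,*}$. $\mathcal{CA}_{0,p}$ is the subspace of those $f\in\mathcal{CA}_p$ with $\lim_{|I|\to0}|I|^{-p}\int_I|f(\xi)-f_I|^2|d\xi|=0$. (For $p=0$ both spaces equal $\mathcal H^2$.) "$\mathsf S^\phi$ is bounded on $\mathcal X$" means that $\phi\circ f\in\mathcal X$ for every $f\in\mathcal X$ and that $\mathsf S^\phi$ maps norm-bounded subsets of $\mathcal X$ to norm-bounded subsets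 of $\mathcal X$. *)

theory Defs
  imports "HOL-Complex_Analysis.Complex_Analysis"
begin

text \<open>Functions on the unit disk are total functions \<^typ>\<open>complex \<Rightarrow> complex\<close>; all notions below
  depend only on their values on the open unit disk.\<close>

definition hardy2 :: "(complex \<Rightarrow> complex) set" where
  "hardy2 = {f. f holomorphic_on ball 0 1 \<and>
     bdd_above ((\<lambda>r::real. LINT \<theta>:{0..2 * pi}|lebesgue. (cmod (f (of_real r * cis \<theta>)))\<^sup>2) ` {0..<1})}"

text \<open>For \<^term>\<open>f \<in> hardy2\<close> the radial limit exists for almost every point of the unit circle; at the
  remaining points the value is a fixed unspecified constant.\<close>

definition radial_limit :: "(complex \<Rightarrow> complex) \<Rightarrow> complex \<Rightarrow> complex" where
  "radial_limit f \<xi> = Lim (at_left (1::real)) (\<lambda>r. f (of_real r * \<xi>))"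

text \<open>A pair \<^term>\<open>(\<alpha>, \<beta>)\<close> of angles stands for the arc of all \<^term>\<open>cis \<theta>\<close> with
  \<^prop>\<open>\<alpha> \<le> \<theta> \<and> \<theta> \<le> \<beta>\<close>. Every nondegenerate arc, up to its endpoints, arises in this way, the whole
  circle included.\<close>

definition arcs :: "(real \<times> real) set" where
  "arcs = {(\<alpha>, \<beta>). \<alpha> < \<beta> \<and> \<beta> \<le> \<alpha> + 2 * pi}"

definition arc_integral ::
    "real \<times> real \<Rightarrow> (complex \<Rightarrow> 'a::{banach, second_countable_topology}) \<Rightarrow> 'a" where
  "arc_integral I g = (LINT \<theta>:{fst I..snd I}|lebesgue. g (cis \<theta>))"

definition arc_length :: "real \<times> real \<Rightarrow> real" where
  "arc_length I = arc_integral I (\<lambda>\<xi>. 1) / (2 * pi)"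

definition arc_mean :: "real \<times> real \<Rightarrow> (complex \<Rightarrow> complex) \<Rightarrow> complex" where
  "arc_mean I g = arc_integral I g / of_real (2 * pi * arc_length I)"

definition arc_oscillation :: "real \<Rightarrow> (complex \<Rightarrow> complex) \<Rightarrow> real \<times> real \<Rightarrow> real" where
  "arc_oscillation p f I =
     arc_length I powr (- p) *
     arc_integral I (\<lambda>\<xi>. (cmod (radial_limit f \<xi> - arc_mean I (radial_limit f)))\<^sup>2)"

definition CA :: "real \<Rightarrow> (complex \<Rightarrow> complex) set" where
  "CA p = {f \<in> hardy2. bdd_above ((\<lambda>I. sqrt (arc_oscillation p f I)) ` arcs)}"

definition CA_seminorm :: "real \<Rightarrow> (complex \<Rightarrow> complex) \<Rightarrow> real" where
  "CA_seminorm p f = (SUP I\<in>arcs. sqrt (arc_oscillation p f I))"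

definition CA_norm :: "real \<Rightarrow> (complex \<Rightarrow> complex) \<Rightarrow> real" where
  "CA_norm p f = cmod (f 0) + CA_seminorm p f"

definition CA0 :: "real \<Rightarrow> (complex \<Rightarrow> complex) set" where
  "CA0 p = {f \<in> CA p. \<forall>\<epsilon>>0. \<exists>\<delta>>0. \<forall>I\<in>arcs. arc_length I < \<delta> \<longrightarrow> \<bar>arc_oscillation p f I\<bar> < \<epsilon>}"

definition superposition :: "(complex \<Rightarrow> complex) \<Rightarrow> (complex \<Rightarrow> complex) \<Rightarrow> (complex \<Rightarrow> complex)" where
  "superposition \<phi> f = \<phi> \<circ> f"

definition maps_boundedly ::
    "('f \<Rightarrow> real) \<Rightarrow> 'f set \<Rightarrow> ('f \<Rightarrow> 'f) \<Rightarrow> bool" where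
  "maps_boundedly N X S \<longleftrightarrow>
     (\<forall>f\<in>X. S f \<in> X) \<and>
     (\<forall>A\<subseteq>X. (\<exists>M. \<forall>f\<in>A. N f \<le> M) \<longrightarrow> (\<exists>M. \<forall>f\<in>A. N (S f) \<le> M))"

end

theory Submission
  imports Defs
begin

text \<open>Sufficiency is immediate once the radial limit of \<open>a f + b\<close> is known to be
  \<open>a\<close> times the radial limit of \<open>f\<close> plus \<open>b\<close> almost everywhere, which needs Fatou's theorem for
  \<open>\<H>\<^sup>2\<close>. The latter follows from a weak type bound for the radial maximal function (the Poisson
  majorant of \<open>\<bar>f\<bar>\<^sup>2\<close> together with Vitali's covering lemma) and from the convergence of
  the dilations \<open>f(\<rho> z)\<close> to \<open>f\<close> in \<open>\<H>\<^sup>2\<close>.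

  For necessity, the functions \<open>f\<^sub>h(z) = h powr ((1 + p) / 2) / (1 - (1 - h) z)\<close>, multiplied by unimodular \<open>w\<close>,
  are bounded in \<open>CA p\<close> uniformly in \<open>h\<close> and \<open>w\<close>. Averaging the odd part of \<open>\<phi> \<circ> (w f\<^sub>h)\<close> over angles of size
  \<open>h\<close> gives an entire function of \<open>w\<close> that is \<open>O(h R)\<close> on the unit circle, where \<open>R = h powr (- (1 - p) / 2)\<close>,
  while its \<open>n\<close>-th Taylor coefficient is that of \<open>\<phi>\<close> times a quantity of size \<open>h R\<^sup>n\<close>.
  Letting \<open>h\<close> tend to \<open>0\<close> kills all coefficients with \<open>n \<ge> 2\<close>.\<close>

section \<open>The Poisson integral on the circle\<close>

text \<open>Where no limit exists, \<open>radial_limit\<close> is an arbitrary fixed value, and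
  affine maps do not commute with it; so even the easy direction has to know that the exceptional
  set is null. In the other direction \<open>\<phi>\<close> is entire and the test functions are
  holomorphic on the closed disk, so radial limits are ordinary values. On the circle, the squared
  modulus of a test function is, up to a bounded factor, \<open>h powr p\<close> times the Poisson
  kernel at \<open>1 - h\<close>: a peak of width about \<open>h\<close> and height R, the largest
  order of height that the seminorm allows at that width. R tends to infinity because
  \<open>p < 1\<close>. The obstacle is that the seminorm sees a function on an arc only in square
  mean and up to a constant, so the size of \<open>\<phi>\<close> near R cannot be read off. The odd
  part in the angle removes the unknown constant, and the freedom in the unimodular factor turns the
  bound into a Cauchy estimate that isolates one Taylor coefficient. Affine maps survive because for
  n = 1 both sides have order h R.\<close>

lemma integral_periodic_shift_le:
  fixes q :: "real \<Rightarrow> 'a::banach"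
  assumes cont: "continuous_on UNIV q" and per: "\<And>t. q (t + d) = q t" and "0 \<le> d" "a \<le> b"
  shows "integral {a..a + d} q = integral {b..b + d} q"
proof -
  have int: "q integrable_on {u..v}" for u v
    by (intro integrable_continuous_real continuous_on_subset[OF cont]) auto
  have "integral {a + d..b + d} q = integral {a..b} q"
  proof (rule integral_unique)
    have "(q \<circ> (+) d) = q"
      using per by (auto simp: add.commute)
    then show "(q has_integral integral {a..b} q) {a + d..b + d}"
      using has_integral_shift_Icc_real[of q d "integral {a..b} q" a b] int by auto
  qed
  moreover have "integral {a..a + d} q + integral {a + d..b + d} q = integral {a..b + d} q"
    by (rule Henstock_Kurzweil_Integration.integral_combine) (use assms int in auto)
  moreover have "integral {a..b} q + integral {b..b + d} q = integral {a..b + d} q"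
    by (rule Henstock_Kurzweil_Integration.integral_combine) (use assms int in auto)
  ultimately show ?thesis
    by (metis add.commute add_left_cancel)
qed

lemma integral_periodic_shift:
  fixes q :: "real \<Rightarrow> 'a::banach"
  assumes "continuous_on UNIV q" and "\<And>t. q (t + d) = q t" and "0 \<le> d"
  shows "integral {a..a + d} q = integral {b..b + d} q"
  using integral_periodic_shift_le[OF assms, of a b] integral_periodic_shift_le[OF assms, of b a]
  by (metis linear)

lemma cis_add_2pi: "cis (t + 2 * pi) = cis t"
  by (rule complex_eqI) simp_all

lemma integral_circle_shift:
  fixes g :: "complex \<Rightarrow> 'a::banach"
  assumes "continuous_on (sphere 0 1) g"
  shows "integral {a..a + 2 * pi} (\<lambda>t. g (cis t)) = integral {b..b + 2 * pi} (\<lambda>t. g (cis t))"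
  by (rule integral_periodic_shift)
     (auto simp: cis_add_2pi intro!: continuous_intros continuous_on_compose2[OF assms])

text \<open>The Poisson kernel of the real point \<open>x\<close>, unnormalised: its mass over a
  period is \<open>2 * pi\<close>. Other points of the disk are brought to the real axis by rotating
  the function, as in \<open>radial_bound_of_means\<close>.\<close>

definition poisson :: "real \<Rightarrow> real \<Rightarrow> real" where
  "poisson x t = (1 - x\<^sup>2) / (cmod (1 - of_real x * cis t))\<^sup>2"

lemma cmod_one_minus_cis: "(cmod (1 - of_real x * cis t))\<^sup>2 = 1 - 2 * x * cos t + x\<^sup>2"
  using sin_cos_squared_add[of t] unfolding cmod_power2 by (simp add: power2_eq_square) algebra

lemma one_minus_cis_nonzero:
  fixes x :: real
  assumes "\<bar>x\<bar> < 1"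
  shows "1 - of_real x * cis t \<noteq> 0"
proof
  assume "1 - of_real x * cis t = 0"
  then have "cmod (of_real x * cis t) = 1" by simp
  then show False using assms by (simp add: norm_mult)
qed

lemma poisson_denominator_pos:
  fixes x :: real
  shows "\<bar>x\<bar> < 1 \<Longrightarrow> 0 < 1 - 2 * x * cos t + x\<^sup>2"
  using one_minus_cis_nonzero[of x t] by (simp flip: cmod_one_minus_cis)

lemma poisson_nonneg: "\<bar>x\<bar> < 1 \<Longrightarrow> 0 \<le> poisson x t"
  by (simp add: poisson_def abs_square_le_1)

lemma poisson_minus: "poisson x (- t) = poisson x t"
  by (simp add: poisson_def cmod_one_minus_cis)

lemma continuous_on_poisson: "\<bar>x\<bar> < 1 \<Longrightarrow> continuous_on A (poisson x)"
  unfolding poisson_def using one_minus_cis_nonzero by (intro continuous_intros) auto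

text \<open>Cauchy's formula for \<open>g(\<zeta>) (1 - x\<^sup>2) / (1 - x \<zeta>)\<close>, whose value at \<open>x\<close> is \<open>g(x)\<close>.\<close>

lemma poisson_integral_0_2pi:
  fixes g :: "complex \<Rightarrow> complex"
  assumes g: "g holomorphic_on cball 0 1" and x: "\<bar>x\<bar> < 1"
  shows "((\<lambda>t. of_real (poisson x t) * g (cis t)) has_integral (2 * pi * g (of_real x))) {0..2 * pi}"
proof -
  define k :: "complex \<Rightarrow> complex" where "k \<zeta> = g \<zeta> * (1 - of_real x ^ 2) / (1 - of_real x * \<zeta>)" for \<zeta>
  have nz: "1 - of_real x * \<zeta> \<noteq> 0" if "cmod \<zeta> \<le> 1" for \<zeta>
  proof
    assume "1 - of_real x * \<zeta> = 0"
    then have "cmod (of_real x * \<zeta>) = 1" by simp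
    then show False using that x mult_left_le[of "cmod \<zeta>" "\<bar>x\<bar>"] by (simp add: norm_mult)
  qed
  have "k holomorphic_on cball 0 1"
    unfolding k_def using nz by (intro holomorphic_intros g) auto
  moreover have "cmod (of_real x - 0) < 1" using x by simp
  ultimately have "((\<lambda>u. k u / (u - of_real x)) has_contour_integral 2 * of_real pi * \<i> * k (of_real x)) (circlepath 0 1)"
    by (rule Cauchy_integral_circlepath_simple)
  then have "((\<lambda>t. k (cis t) / (cis t - of_real x) * \<i> * cis t) has_integral (2 * of_real pi * \<i> * k (of_real x))) {0..2 * pi}"
    unfolding circlepath_def by (subst (asm) has_contour_integral_part_circlepath_iff) auto
  then have 1: "((\<lambda>t. - \<i> * (k (cis t) / (cis t - of_real x) * \<i> * cis t)) has_integral (- \<i> * (2 * of_real pi * \<i> * k (of_real x)))) {0..2 * pi}"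
    by (rule has_integral_mult_right)
  have x2: "(1::complex) - (of_real x)\<^sup>2 \<noteq> 0"
    using x by (metis abs_square_less_1 eq_iff_diff_eq_0 less_irrefl of_real_1 of_real_eq_iff of_real_power)
  have 2: "- \<i> * (k (cis t) / (cis t - of_real x) * \<i> * cis t) = of_real (poisson x t) * g (cis t)" for t
  proof -
    \<comment> \<open>Conjugation inverts points of the circle, so the Cauchy denominator is, up to
      the factor \<open>cis t\<close>, the conjugate of the denominator in \<open>k\<close>;
      together they form the squared modulus.\<close>
    have c: "cis t - of_real x = cis t * cnj (1 - of_real x * cis t)"
      by (simp add: right_diff_distrib cis_cnj cis_mult)
    have "k (cis t) / (cis t - of_real x) * cis t =
          g (cis t) * (1 - of_real x ^ 2) / ((1 - of_real x * cis t) * cnj (1 - of_real x * cis t))"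
      unfolding k_def c by simp
    also have "\<dots> = of_real (poisson x t) * g (cis t)"
      unfolding poisson_def complex_norm_square[symmetric] by simp
    finally have "k (cis t) / (cis t - of_real x) * cis t = of_real (poisson x t) * g (cis t)" .
    moreover have "- \<i> * (u * \<i> * v) = u * v" for u v
      by (simp add: complex_eq_iff)
    ultimately show ?thesis by presburger
  qed
  have 3: "k (of_real x) = g (of_real x)"
    unfolding k_def using x2 by (simp add: power2_eq_square)
  show ?thesis
  proof -
    have 4: "- \<i> * (2 * of_real pi * \<i> * v) = 2 * of_real pi * v" for v
      by (simp add: complex_eq_iff)
    show ?thesis
      using 1 unfolding 2 3 4 by simp
  qed
qed

text \<open>Moved to the symmetric period, where the evenness of the kernel can be used.\<close>

lemma poisson_integral:
  fixes g :: "complex \<Rightarrow> complex"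
  assumes g: "g holomorphic_on cball 0 1" and x: "\<bar>x\<bar> < 1"
  shows "((\<lambda>t. of_real (poisson x t) * g (cis t)) has_integral (2 * pi * g (of_real x))) {- pi..pi}"
proof -
  have gc: "continuous_on (sphere 0 1) g"
    by (rule holomorphic_on_imp_continuous_on[THEN continuous_on_subset, OF g]) auto
  have cont: "continuous_on UNIV (\<lambda>t. of_real (poisson x t) * g (cis t))"
    by (intro continuous_intros continuous_on_poisson x continuous_on_compose2[OF gc]) auto
  have "integral {- pi..- pi + 2 * pi} (\<lambda>t. of_real (poisson x t) * g (cis t)) =
        integral {0..0 + 2 * pi} (\<lambda>t. of_real (poisson x t) * g (cis t))"
    by (rule integral_periodic_shift[OF cont]) (auto simp: poisson_def cis_add_2pi)
  also have "\<dots> = 2 * pi * g (of_real x)"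
    using poisson_integral_0_2pi[OF g x] by (simp add: integral_unique)
  finally show ?thesis
    using integrable_continuous_real[OF continuous_on_subset[OF cont], of "-pi" pi]
    by (simp add: has_integral_iff)
qed

lemma poisson_integral_one:
  assumes x: "\<bar>x\<bar> < 1"
  shows "(poisson x has_integral 2 * pi) {- pi..pi}"
  using has_integral_linear[OF poisson_integral[of "\<lambda>_. 1", OF holomorphic_on_const x] bounded_linear_Re]
  by (simp add: o_def)

text \<open>The square of \<open>g\<close> is again holomorphic, with modulus
  \<open>(cmod (g z))\<^sup>2\<close>, so the reproducing formula for it and positivity of the
  kernel give the estimate.\<close>

lemma poisson_bound_square:
  fixes g :: "complex \<Rightarrow> complex"
  assumes g: "g holomorphic_on cball 0 1" and x: "\<bar>x\<bar> < 1"
  shows "2 * pi * (cmod (g (of_real x)))\<^sup>2 \<le> integral {- pi..pi} (\<lambda>t. poisson x t * (cmod (g (cis t)))\<^sup>2)"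
proof -
  have gc: "continuous_on (sphere 0 1) g"
    by (rule holomorphic_on_imp_continuous_on[THEN continuous_on_subset, OF g]) auto
  have cont: "continuous_on UNIV (\<lambda>t. poisson x t * (cmod (g (cis t)))\<^sup>2)"
    by (intro continuous_intros continuous_on_poisson x continuous_on_compose2[OF gc]) auto
  have "2 * pi * (cmod (g (of_real x)))\<^sup>2 = norm (2 * pi * (g (of_real x))\<^sup>2)"
    by (simp add: norm_mult norm_power)
  also have "\<dots> = norm (integral {-pi..pi} (\<lambda>t. of_real (poisson x t) * (g (cis t))\<^sup>2))"
    using poisson_integral[of "\<lambda>z. g z ^ 2", OF _ x] g
    by (simp add: integral_unique holomorphic_intros)
  also have "\<dots> \<le> integral {- pi..pi} (\<lambda>t. poisson x t * (cmod (g (cis t)))\<^sup>2)"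
    by (rule integral_norm_bound_integral)
       (use poisson_integral[of "\<lambda>z. g z ^ 2", OF _ x] g cont poisson_nonneg[OF x] in
        \<open>auto simp: norm_mult norm_power holomorphic_intros has_integral_iff
              intro!: integrable_continuous_real intro: continuous_on_subset\<close>)
  finally show ?thesis .
qed

text \<open>Integration by parts: a decreasing kernel is a superposition of indicators of intervals
  \<open>{0..s}\<close>, so a bound on the averages of \<open>\<nu>\<close> over these intervals
  carries over. \<open>W\<close> is the boundary term; its derivative exceeds
  \<open>P t * (\<nu> t - l)\<close> by a product of two nonpositive factors.\<close>

lemma decreasing_kernel_integral_le:
  fixes P P' \<nu> :: "real \<Rightarrow> real"
  assumes P: "\<And>t. (P has_real_derivative P' t) (at t)" and P'c: "continuous_on UNIV P'"
    and P': "\<And>t. t \<in> {0..c} \<Longrightarrow> P' t \<le> 0" and P0: "P c \<ge> 0" and c: "0 \<le> c"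
    and \<nu>: "continuous_on {0..c} \<nu>"
    and le: "\<And>s. s \<in> {0..c} \<Longrightarrow> integral {0..s} \<nu> \<le> l * s"
  shows "integral {0..c} (\<lambda>t. P t * \<nu> t) \<le> l * integral {0..c} P"
proof -
  define N where "N s = integral {0..s} \<nu>" for s
  define W where "W s = P s * (N s - l * s)" for s
  have Pc: "continuous_on A P" for A
    using P by (meson DERIV_isCont continuous_at_imp_continuous_on)
  have N: "(N has_real_derivative \<nu> t) (at t within {0..c})" if "t \<in> {0..c}" for t
    unfolding N_def using integral_has_real_derivative[OF \<nu> that] .
  have W: "(W has_vector_derivative (P' t * (N t - l * t) + P t * (\<nu> t - l))) (at t within {0..c})"
    if "t \<in> {0..c}" for t
    unfolding W_def has_real_derivative_iff_has_vector_derivative[symmetric]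
    by (rule derivative_eq_intros N[OF that] DERIV_subset[OF P] subset_UNIV refl)+ (simp add: algebra_simps)
  have Wint: "((\<lambda>t. P' t * (N t - l * t) + P t * (\<nu> t - l)) has_integral W c - W 0) {0..c}"
    by (rule fundamental_theorem_of_calculus[OF c W])
  have int: "(\<lambda>t. P t * \<nu> t) integrable_on {0..c}" "P integrable_on {0..c}"
    by (intro integrable_continuous_real continuous_intros Pc \<nu>)+
  then have "((\<lambda>t. P t * \<nu> t - l * P t) has_integral
     integral {0..c} (\<lambda>t. P t * \<nu> t) - l * integral {0..c} P) {0..c}"
    by (intro has_integral_diff has_integral_mult_right) (auto simp: has_integral_integral)
  then have "integral {0..c} (\<lambda>t. P t * \<nu> t) - l * integral {0..c} P \<le> W c - W 0"
  proof (rule has_integral_le[OF _ Wint])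
    fix t assume t: "t \<in> {0..c}"
    have "0 \<le> P' t * (N t - l * t)"
      using P'[OF t] le[OF t] by (simp add: N_def mult_nonpos_nonpos)
    then show "P t * \<nu> t - l * P t \<le> P' t * (N t - l * t) + P t * (\<nu> t - l)"
      by (simp add: algebra_simps)
  qed
  moreover have "W 0 = 0" by (simp add: W_def N_def)
  moreover have "W c \<le> 0" using P0 le[of c] c by (simp add: W_def N_def mult_nonneg_nonpos)
  ultimately show ?thesis by simp
qed

lemma integral_symmetric_interval:
  fixes q :: "real \<Rightarrow> 'a::euclidean_space"
  assumes "continuous_on {-c..c} q" "0 \<le> c"
  shows "integral {-c..c} q = integral {0..c} (\<lambda>t. q t + q (- t))"
proof -
  have int: "q integrable_on {u..v}" if "-c \<le> u" "v \<le> c" for u v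
    by (intro integrable_continuous_real continuous_on_subset[OF assms(1)]) (use that in auto)
  have "integral {-c..c} q = integral {-c..0} q + integral {0..c} q"
    by (rule Henstock_Kurzweil_Integration.integral_combine[symmetric]) (use assms int in auto)
  also have "integral {-c..0} q = integral {0..c} (\<lambda>t. q (-t))"
    using Henstock_Kurzweil_Integration.integral_reflect_real[where f = "\<lambda>t. q (-t)" and a = 0 and b = c] by simp
  also have "integral {0..c} (\<lambda>t. q (- t)) + integral {0..c} q = integral {0..c} (\<lambda>t. q t + q (- t))"
  proof (subst integral_add)
    show "(\<lambda>t. q (- t)) integrable_on {0..c}"
      using Henstock_Kurzweil_Integration.integrable_reflect_real[where f=q and a="-c" and b=0] int[of "-c" 0] assms
      by simp
  qed (use assms int in \<open>auto simp: add.commute\<close>)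
  finally show ?thesis .
qed

text \<open>The Poisson kernel decreases on \<open>{0..pi}\<close>, so averages of the squared
  modulus over arcs centred at \<open>1\<close> control all points of the radius at once. Half of
  the kernel's mass is \<open>pi\<close>, against \<open>2 * pi\<close> on the left of
  \<open>poisson_bound_square\<close>; this explains the factor \<open>2\<close>.\<close>

lemma poisson_bound_of_means:
  fixes g :: "complex \<Rightarrow> complex"
  assumes g: "g holomorphic_on cball 0 1" and x: "0 \<le> x" "x < 1"
    and le: "\<And>s. 0 < s \<Longrightarrow> s \<le> pi \<Longrightarrow> integral {-s..s} (\<lambda>t. (cmod (g (cis t)))\<^sup>2) \<le> l * s"
  shows "2 * (cmod (g (of_real x)))\<^sup>2 \<le> l"
proof -
  have x': "\<bar>x\<bar> < 1" using x by simp
  have gc: "continuous_on (sphere 0 1) g"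
    by (rule holomorphic_on_imp_continuous_on[THEN continuous_on_subset, OF g]) auto
  define \<mu> where "\<mu> t = (cmod (g (cis t)))\<^sup>2" for t
  have \<mu>c: "continuous_on A \<mu>" for A
    unfolding \<mu>_def by (intro continuous_intros continuous_on_compose2[OF gc]) auto
  have \<mu>c': "continuous_on A (\<lambda>t. \<mu> (- t))" for A
    by (rule continuous_on_compose2[OF \<mu>c[of UNIV]]) (auto intro!: continuous_intros)
  have pos: "0 < 1 - 2 * x * cos t + x\<^sup>2" for t by (rule poisson_denominator_pos[OF x'])
  define P' where "P' t = - ((1 - x\<^sup>2) * (2 * x * sin t) / (1 - 2 * x * cos t + x\<^sup>2)\<^sup>2)" for t
  have P_eq: "poisson x t = (1 - x\<^sup>2) / (1 - 2 * x * cos t + x\<^sup>2)" for t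
    unfolding poisson_def cmod_one_minus_cis ..
  have "2 * pi * (cmod (g (of_real x)))\<^sup>2 \<le> integral {- pi..pi} (\<lambda>t. poisson x t * \<mu> t)"
    unfolding \<mu>_def by (rule poisson_bound_square[OF g x'])
  also have "\<dots> = integral {0..pi} (\<lambda>t. poisson x t * (\<mu> t + \<mu> (- t)))"
    by (subst integral_symmetric_interval)
       (auto intro!: continuous_intros continuous_on_poisson x' \<mu>c simp: poisson_minus algebra_simps)
  also have "\<dots> \<le> l * integral {0..pi} (poisson x)"
  proof (rule decreasing_kernel_integral_le)
    show "(poisson x has_real_derivative P' t) (at t)" for t
      unfolding P'_def P_eq[abs_def] using pos[of t]
      by (auto intro!: derivative_eq_intros simp: power2_eq_square)
    show "continuous_on UNIV P'"
      unfolding P'_def using pos by (intro continuous_intros) (auto simp: less_imp_neq[THEN not_sym])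
    \<comment> \<open>Here \<open>0 \<le> x\<close> matters: for negative \<open>x\<close> the
      kernel increases away from \<open>0\<close>.\<close>
    show "P' t \<le> 0" if "t \<in> {0..pi}" for t
    proof -
      have "0 \<le> sin t" using that by (simp add: sin_ge_zero)
      then have "0 \<le> (1 - x\<^sup>2) * (2 * x * sin t) / (1 - 2 * x * cos t + x\<^sup>2)\<^sup>2"
        using x by (intro divide_nonneg_nonneg mult_nonneg_nonneg) (auto simp: abs_square_le_1)
      then show ?thesis unfolding P'_def by simp
    qed
    show "0 \<le> poisson x pi" by (rule poisson_nonneg[OF x'])
    show "integral {0..s} (\<lambda>t. \<mu> t + \<mu> (- t)) \<le> l * s" if "s \<in> {0..pi}" for s
      using le[of s] that integral_symmetric_interval[OF \<mu>c, of s]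
      by (cases "s = 0") (auto simp: \<mu>_def[abs_def])
  qed (auto intro!: continuous_intros \<mu>c \<mu>c')
  also have "integral {0..pi} (poisson x) = pi"
  proof -
    have "2 * pi = integral {-pi..pi} (poisson x)"
      using poisson_integral_one[OF x'] by (simp add: integral_unique)
    also have "\<dots> = integral {0..pi} (\<lambda>t. poisson x t + poisson x (- t))"
      by (rule integral_symmetric_interval) (auto intro!: continuous_on_poisson x')
    also have "\<dots> = 2 * integral {0..pi} (poisson x)"
      by (simp add: poisson_minus flip: mult_2)
    finally show ?thesis by simp
  qed
  finally have "pi * (2 * (cmod (g (of_real x)))\<^sup>2) \<le> pi * l" by (simp add: mult_ac)
  then show ?thesis by simp
qed

section \<open>The radial maximal function\<close>

text \<open>Shrinking makes a function on the open disk holomorphic on the closed one, where the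
  Poisson formula holds; \<open>c\<close> serves for rotations.\<close>

lemma holomorphic_on_cball_dilation:
  fixes g :: "complex \<Rightarrow> complex"
  assumes "0 \<le> \<rho>" "\<rho> < 1" "g holomorphic_on ball 0 1" "cmod c \<le> 1"
  shows "(\<lambda>z. g (of_real \<rho> * c * z)) holomorphic_on cball 0 1"
proof -
  have *: "cmod (of_real \<rho> * c * z) < 1" if "cmod z \<le> 1" for z
  proof -
    have "cmod c * cmod z \<le> 1" using \<open>cmod c \<le> 1\<close> that by (simp add: mult_le_one)
    then have "\<rho> * (cmod c * cmod z) \<le> \<rho>" using assms by (simp add: mult_left_le)
    then show ?thesis using assms by (simp add: norm_mult mult.assoc)
  qed
  have "g \<circ> (\<lambda>z. of_real \<rho> * c * z) holomorphic_on cball 0 1"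
    by (rule holomorphic_on_compose_gen[OF _ assms(3)]) (use * in \<open>auto intro!: holomorphic_intros\<close>)
  then show ?thesis by (simp add: o_def)
qed

lemma continuous_on_circle_of_radius:
  assumes "g holomorphic_on ball 0 1" "0 \<le> r" "r < 1"
  shows "continuous_on A (\<lambda>t. g (of_real r * cis t))"
  by (rule continuous_on_compose2[OF holomorphic_on_imp_continuous_on[OF assms(1)]])
     (use assms in \<open>auto intro!: continuous_intros simp: norm_mult\<close>)

text \<open>Dilation by \<open>\<rho>\<close> and rotation by \<open>\<theta>\<close> turn the point
  into the real point \<open>r / \<rho>\<close>, which is still below \<open>1\<close>.\<close>

lemma radial_bound_of_means:
  assumes g: "g holomorphic_on ball 0 1" and r: "0 \<le> r" "r < \<rho>" "\<rho> < 1"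
    and le: "\<And>s. 0 < s \<Longrightarrow> s \<le> pi \<Longrightarrow>
      integral {\<theta> - s..\<theta> + s} (\<lambda>t. (cmod (g (of_real \<rho> * cis t)))\<^sup>2) \<le> l * s"
  shows "2 * (cmod (g (of_real r * cis \<theta>)))\<^sup>2 \<le> l"
proof -
  define G where "G z = g (of_real \<rho> * cis \<theta> * z)" for z
  have G: "G holomorphic_on cball 0 1"
    unfolding G_def by (rule holomorphic_on_cball_dilation) (use assms in auto)
  have "2 * (cmod (G (of_real (r / \<rho>))))\<^sup>2 \<le> l"
  proof (rule poisson_bound_of_means[OF G])
    fix s :: real assume s: "0 < s" "s \<le> pi"
    have "integral {-s..s} (\<lambda>t. (cmod (G (cis t)))\<^sup>2) =
          integral {-s..s} ((\<lambda>t. (cmod (g (of_real \<rho> * cis t)))\<^sup>2) \<circ> (+) \<theta>)"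
      by (simp add: G_def mult.assoc cis_mult o_def)
    also have "\<dots> = integral {-s + \<theta>..s + \<theta>} (\<lambda>t. (cmod (g (of_real \<rho> * cis t)))\<^sup>2)"
    proof (rule integral_unique, subst has_integral_shift_Icc_real)
      show "((\<lambda>t. (cmod (g (of_real \<rho> * cis t)))\<^sup>2) has_integral
        integral {-s + \<theta>..s + \<theta>} (\<lambda>t. (cmod (g (of_real \<rho> * cis t)))\<^sup>2)) {-s + \<theta>..s + \<theta>}"
        by (intro integrable_integral integrable_continuous_real continuous_intros continuous_on_circle_of_radius g)
           (use r in auto)
    qed
    finally show "integral {-s..s} (\<lambda>t. (cmod (G (cis t)))\<^sup>2) \<le> l * s"
      using le[OF s] by (simp add: add.commute)
  qed (use r in auto)
  then show ?thesis
    using r by (simp add: G_def mult.commute mult.left_commute)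
qed

text \<open>By the contrapositive of \<open>radial_bound_of_means\<close>, each point of
  \<open>S\<close> is the centre of an interval carrying much of the mass of \<open>\<mu>\<close>;
  Vitali's lemma picks disjoint ones whose fivefold enlargements cover \<open>S\<close>. The circle
  has radius \<open>\<rho> < 1\<close> so that \<open>\<mu>\<close> is continuous.\<close>

lemma radial_maximal_weak_type_below:
  fixes a :: real
  assumes g: "g holomorphic_on ball 0 1" and \<rho>: "0 < \<rho>" "\<rho> < 1" and l: "0 < l"
    and bd: "\<And>b. integral {b..b + 2 * pi} (\<lambda>t. (cmod (g (of_real \<rho> * cis t)))\<^sup>2) \<le> K"
  defines "S \<equiv> {\<theta> \<in> {a..a + 2 * pi}. \<exists>r\<in>{0..<\<rho>}. (cmod (g (of_real r * cis \<theta>)))\<^sup>2 > l}"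
  shows "S \<in> lmeasurable" "measure lebesgue S \<le> 10 * K / l"
proof -
  define \<mu> where "\<mu> t = (cmod (g (of_real \<rho> * cis t)))\<^sup>2" for t
  have \<mu>c: "continuous_on A \<mu>" for A
    unfolding \<mu>_def by (intro continuous_intros continuous_on_circle_of_radius g) (use \<rho> in auto)
  have \<mu>0: "0 \<le> \<mu> t" for t by (simp add: \<mu>_def)
  have \<mu>i: "\<mu> integrable_on {u..v}" for u v
    by (intro integrable_continuous_real \<mu>c)
  have "\<exists>s. 0 < s \<and> s \<le> pi \<and> 2 * l * s < integral {\<theta> - s..\<theta> + s} \<mu>" if \<theta>: "\<theta> \<in> S" for \<theta>
  proof (rule ccontr)
    obtain r where r: "0 \<le> r" "r < \<rho>" "(cmod (g (of_real r * cis \<theta>)))\<^sup>2 > l"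
      using \<theta> by (auto simp: S_def)
    assume "\<not> ?thesis"
    then have "integral {\<theta> - s..\<theta> + s} (\<lambda>t. (cmod (g (of_real \<rho> * cis t)))\<^sup>2) \<le> 2 * l * s"
      if "0 < s" "s \<le> pi" for s
      using that by (auto simp: \<mu>_def[abs_def] not_less)
    then have "2 * (cmod (g (of_real r * cis \<theta>)))\<^sup>2 \<le> 2 * l"
      by (rule radial_bound_of_means[OF g r(1,2) \<rho>(2)])
    then show False using r by simp
  qed
  then obtain s where s: "\<And>\<theta>. \<theta> \<in> S \<Longrightarrow> 0 < s \<theta> \<and> s \<theta> \<le> pi \<and> 2 * l * s \<theta> < integral {\<theta> - s \<theta>..\<theta> + s \<theta>} \<mu>"
    by metis
  have "S \<subseteq> (\<Union>\<theta>\<in>S. ball \<theta> (s \<theta>))"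
    using s by fastforce
  then obtain C where C: "countable C" "C \<subseteq> S"
     "pairwise (\<lambda>i j. disjnt (ball i (s i)) (ball j (s j))) C"
     "S \<subseteq> (\<Union>i\<in>C. ball i (5 * s i))"
    by (rule Vitali_covering_lemma_balls[of S "\<lambda>i. i" s S pi]) (use s in auto)
  \<comment> \<open>The constant: a fivefold interval has length \<open>10 * s i\<close>, less than
    \<open>5 / l\<close> times the mass of the original one. Radii at most \<open>pi\<close> keep
    the disjoint intervals within two periods, so the total mass is at most
    \<open>2 * K\<close>.\<close>
  have fin: "measure lebesgue (\<Union>i\<in>F. ball i (5 * s i)) \<le> 10 * K / l" if F: "F \<subseteq> C" "finite F" for F
  proof -
    have sF: "0 < s i \<and> s i \<le> pi \<and> 2 * l * s i < integral {i - s i..i + s i} \<mu>" if "i \<in> F" for i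
      using s F C that by auto
    have UN: "(\<mu> has_integral (\<Sum>i\<in>F. integral (ball i (s i)) \<mu>)) (\<Union>i\<in>F. ball i (s i))"
    proof (rule has_integral_UN)
      show "(\<mu> has_integral integral (ball i (s i)) \<mu>) (ball i (s i))" for i
        using \<mu>i by (auto simp: ball_eq_greaterThanLessThan integrable_on_open_interval_real intro!: integrable_integral)
      show "pairwise (\<lambda>i i'. negligible (ball i (s i) \<inter> ball i' (s i'))) F"
        using C(3) F(1) by (force simp: pairwise_def disjnt_def)
    qed (use F in auto)
    have "measure lebesgue (\<Union>i\<in>F. ball i (5 * s i)) \<le> (\<Sum>i\<in>F. measure lebesgue (ball i (5 * s i)))"
      by (rule measure_UNION_le) (use F in auto)
    also have "\<dots> = (\<Sum>i\<in>F. 10 * s i)"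
      by (rule sum.cong) (use sF in \<open>auto simp: ball_eq_greaterThanLessThan less_imp_le\<close>)
    also have "\<dots> = 5 / l * (\<Sum>i\<in>F. 2 * l * s i)"
      using l by (simp add: sum_distrib_left field_simps)
    also have "\<dots> \<le> 5 / l * (\<Sum>i\<in>F. integral (ball i (s i)) \<mu>)"
      using l sF by (intro mult_left_mono sum_mono)
        (auto simp: ball_eq_greaterThanLessThan integral_open_interval_real less_imp_le)
    also have "(\<Sum>i\<in>F. integral (ball i (s i)) \<mu>) = integral (\<Union>i\<in>F. ball i (s i)) \<mu>"
      using UN by (rule integral_unique[symmetric])
    also have "\<dots> \<le> integral {a - pi..a + 3 * pi} \<mu>"
    proof (rule integral_subset_le)
      have "i \<in> {a..a + 2 * pi}" if "i \<in> F" for i using F C that by (auto simp: S_def)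
      then show "(\<Union>i\<in>F. ball i (s i)) \<subseteq> {a - pi..a + 3 * pi}"
        using sF by (fastforce simp: ball_eq_greaterThanLessThan)
      show "\<mu> integrable_on (\<Union>i\<in>F. ball i (s i))"
        using UN by (auto simp: integrable_on_def)
    qed (use \<mu>i \<mu>0 in auto)
    also have "\<dots> = integral {a - pi..a + pi} \<mu> + integral {a + pi..a + 3 * pi} \<mu>"
      by (rule Henstock_Kurzweil_Integration.integral_combine[symmetric]) (use \<mu>i in auto)
    also have "\<dots> \<le> 2 * K"
      using bd[of "a - pi"] bd[of "a + pi"] by (simp add: \<mu>_def[abs_def] algebra_simps)
    finally show ?thesis using l by (simp add: divide_right_mono)
  qed
  have U: "(\<Union>i\<in>C. ball i (5 * s i)) \<in> lmeasurable" "measure lebesgue (\<Union>i\<in>C. ball i (5 * s i)) \<le> 10 * K / l"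
    by (rule fmeasurable_UN_bound measure_UN_bound; use C fin in auto)+
  \<comment> \<open>Measurability: uncountably many radii occur, but each contributes an open set,
    so the union is open.\<close>
  have "S = {a..a + 2 * pi} \<inter> (\<Union>r\<in>{0..<\<rho>}. {\<theta>. (cmod (g (of_real r * cis \<theta>)))\<^sup>2 > l})"
    by (auto simp: S_def)
  moreover have "open {\<theta>. (cmod (g (of_real r * cis \<theta>)))\<^sup>2 > l}" if "r \<in> {0..<\<rho>}" for r
    by (intro open_Collect_less continuous_intros continuous_on_circle_of_radius g) (use that \<rho> in auto)
  then have "open (\<Union>r\<in>{0..<\<rho>}. {\<theta>. (cmod (g (of_real r * cis \<theta>)))\<^sup>2 > l})" by blast
  ultimately have "S \<in> sets lebesgue"
    by (simp add: borel_open)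
  then show "S \<in> lmeasurable"
    by (rule fmeasurableI2[OF U(1) C(4)])
  then show "measure lebesgue S \<le> 10 * K / l"
    using measure_mono_fmeasurable[OF C(4) fmeasurableD U(1)] U(2) by (meson order_trans)
qed

text \<open>The bound in \<open>radial_maximal_weak_type_below\<close> does not depend on
  \<open>\<rho>\<close> and the sets grow with \<open>\<rho>\<close>, so it passes to a countable
  union along radii tending to \<open>1\<close>.\<close>

lemma radial_maximal_weak_type:
  fixes a :: real
  assumes g: "g holomorphic_on ball 0 1" and l: "0 < l"
    and bd: "\<And>\<rho> b. 0 < \<rho> \<Longrightarrow> \<rho> < 1 \<Longrightarrow> integral {b..b + 2 * pi} (\<lambda>t. (cmod (g (of_real \<rho> * cis t)))\<^sup>2) \<le> K"
  defines "S \<equiv> {\<theta> \<in> {a..a + 2 * pi}. \<exists>r\<in>{0..<1}. (cmod (g (of_real r * cis \<theta>)))\<^sup>2 > l}"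
  shows "S \<in> lmeasurable" "measure lebesgue S \<le> 10 * K / l"
proof -
  define S' where "S' \<rho> = {\<theta> \<in> {a..a + 2 * pi}. \<exists>r\<in>{0..<\<rho>}. (cmod (g (of_real r * cis \<theta>)))\<^sup>2 > l}" for \<rho>
  \<comment> \<open>\<open>n + 2\<close> keeps the radii strictly positive, also at
    \<open>n = 0\<close>.\<close>
  define c where "c n = 1 - 1 / real (n + 2)" for n :: nat
  have c: "0 < c n" "c n < 1" for n by (auto simp: c_def field_simps)
  have mono: "S' r \<subseteq> S' r'" if "r \<le> r'" for r r' using that by (force simp: S'_def)
  have incc: "c m \<le> c n" if "m \<le> n" for m n using that by (auto simp: c_def field_simps)
  have meas: "S' (c n) \<in> lmeasurable" "measure lebesgue (S' (c n)) \<le> 10 * K / l" for n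
    unfolding S'_def by (rule radial_maximal_weak_type_below[OF g c l bd[OF c]])+
  have "S = (\<Union>n. S' (c n))"
  proof
    show "S \<subseteq> (\<Union>n. S' (c n))"
    proof
      fix \<theta> assume "\<theta> \<in> S"
      then obtain r where r: "\<theta> \<in> {a..a + 2 * pi}" "0 \<le> r" "r < 1" "(cmod (g (of_real r * cis \<theta>)))\<^sup>2 > l"
        by (auto simp: S_def)
      have "c \<longlonglongrightarrow> 1 - 0"
        unfolding c_def by (intro tendsto_diff tendsto_const LIMSEQ_ignore_initial_segment lim_1_over_n)
      then have "eventually (\<lambda>n. r < c n) sequentially"
        using r by (intro order_tendstoD) auto
      then obtain n where "r < c n" by (auto simp: eventually_sequentially)
      then show "\<theta> \<in> (\<Union>n. S' (c n))" using r by (auto simp: S'_def intro!: exI[of _ n] bexI[of _ r])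
    qed
    show "(\<Union>n. S' (c n)) \<subseteq> S"
      unfolding S'_def S_def using c(2) by (fastforce intro: less_trans)
  qed
  moreover have fin: "measure lebesgue (\<Union>n\<in>F. S' (c n)) \<le> 10 * K / l" if F: "F \<subseteq> UNIV" "finite F" for F
  proof (cases "F = {}")
    case True
    have "0 \<le> 10 * K / l" using meas(2)[of 0] by (meson measure_nonneg order_trans)
    then show ?thesis using True by simp
  next
    case False
    then have "(\<Union>n\<in>F. S' (c n)) \<subseteq> S' (c (Max F))"
      using F by (intro UN_least mono incc Max_ge) auto
    moreover have "Max F \<in> F" using False F by auto
    ultimately have "(\<Union>n\<in>F. S' (c n)) = S' (c (Max F))" by blast
    then show ?thesis using meas by simp
  qed
  moreover have "(\<Union>n. S' (c n)) \<in> lmeasurable" "measure lebesgue (\<Union>n. S' (c n)) \<le> 10 * K / l"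
    by (rule fmeasurable_UN_bound measure_UN_bound; use fin meas in auto)+
  ultimately show "S \<in> lmeasurable" "measure lebesgue S \<le> 10 * K / l" by auto
qed

section \<open>Fatou's theorem for the Hardy space\<close>

lemma taylor_coeff_integral:
  fixes f :: "complex \<Rightarrow> complex"
  assumes f: "f holomorphic_on ball 0 1" and r: "0 < r" "r < 1"
  shows "((\<lambda>t. f (of_real r * cis t) * cnj (cis t ^ n)) has_integral
          2 * pi * ((deriv ^^ n) f 0 / fact n * r ^ n)) {0..2 * pi}"
proof -
  have sub: "cball 0 r \<subseteq> ball (0::complex) 1" using r by auto
  have "((\<lambda>u. f u / (u - 0) ^ Suc n) has_contour_integral (2 * pi * \<i> / fact n * (deriv ^^ n) f 0)) (circlepath 0 r)"
  proof (rule Cauchy_has_contour_integral_higher_derivative_circlepath)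
    show "continuous_on (cball 0 r) f"
      using holomorphic_on_imp_continuous_on[OF f] sub by (rule continuous_on_subset)
    show "f holomorphic_on ball 0 r" using f sub by (meson ball_subset_cball holomorphic_on_subset order_trans)
  qed (use r in auto)
  then have "((\<lambda>t. f (of_real r * cis t) / (of_real r * cis t) ^ Suc n * of_real r * \<i> * cis t) has_integral
      (2 * pi * \<i> / fact n * (deriv ^^ n) f 0)) {0..2 * pi}"
    unfolding circlepath_def by (subst (asm) has_contour_integral_part_circlepath_iff) auto
  from has_integral_mult_right[OF this, of "- \<i> * of_real r ^ n"]
  have "((\<lambda>t. (- \<i> * of_real r ^ n) * (f (of_real r * cis t) / (of_real r * cis t) ^ Suc n * of_real r * \<i> * cis t)) has_integral
      (- \<i> * of_real r ^ n) * (2 * pi * \<i> / fact n * (deriv ^^ n) f 0)) {0..2 * pi}" .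
  moreover have "(- \<i> * of_real r ^ n) * (f (of_real r * cis t) / (of_real r * cis t) ^ Suc n * of_real r * \<i> * cis t) =
      f (of_real r * cis t) * cnj (cis t ^ n)" for t
  proof -
    \<comment> \<open>Conjugation is inversion on the circle; this turns the Cauchy kernel into a
      Fourier character.\<close>
    have "cnj (cis t ^ n) * cis t ^ n = 1"
      by (metis complex_cnj_power cis_cnj cis_mult add.left_inverse cis_zero power_mult_distrib power_one)
    then have c: "cnj (cis t ^ n) = 1 / cis t ^ n"
      by (simp add: nonzero_eq_divide_eq)
    show ?thesis
      unfolding c using r by (simp add: power_mult_distrib divide_simps) (simp add: complex_eq_iff)
  qed
  moreover have "(- \<i> * of_real r ^ n) * (2 * pi * \<i> / fact n * (deriv ^^ n) f 0) =
      2 * pi * ((deriv ^^ n) f 0 / fact n * r ^ n)"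
  proof -
    have "- \<i> * u * (v * \<i> * y * x) = v * (x * y * u)" for u v x y
      by (simp add: complex_eq_iff algebra_simps)
    then show ?thesis unfolding divide_inverse of_real_power .
  qed
  ultimately show ?thesis by simp
qed

text \<open>Only the conjugated factor of \<open>f * cnj f\<close> is expanded in its Taylor series;
  each resulting term is a Fourier integral of \<open>f\<close> given by
  \<open>taylor_coeff_integral\<close>, and uniform convergence permits integrating term by
  term.\<close>

lemma parseval_circle:
  fixes f :: "complex \<Rightarrow> complex"
  assumes f: "f holomorphic_on ball 0 1" and r: "0 < r" "r < 1"
  shows "(\<lambda>n. 2 * pi * ((cmod ((deriv ^^ n) f 0 / fact n))\<^sup>2 * (r ^ n)\<^sup>2)) sums
         integral {0..2 * pi} (\<lambda>t. (cmod (f (of_real r * cis t)))\<^sup>2)"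
proof -
  define a where "a n = (deriv ^^ n) f 0 / fact n" for n
  have ps: "(\<lambda>n. a n * z ^ n) sums f z" if "cmod z < 1" for z
    unfolding a_def using holomorphic_power_series[OF f, of z] that by simp
  define h where "h n t = f (of_real r * cis t) * cnj (a n * (of_real r * cis t) ^ n)" for n t
  have fc: "continuous_on A (\<lambda>t. f (of_real r * cis t))" for A
    by (rule continuous_on_circle_of_radius[OF f]) (use r in auto)
  have hc: "continuous_on A (h n)" for A n
    unfolding h_def by (intro continuous_intros fc)
  have "compact ((\<lambda>t. f (of_real r * cis t)) ` {0..2 * pi})"
    by (intro compact_continuous_image fc) auto
  then obtain B where B: "\<And>t. t \<in> {0..2 * pi} \<Longrightarrow> cmod (f (of_real r * cis t)) \<le> B"
    by (meson compact_imp_bounded bounded_iff image_eqI)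
  \<comment> \<open>The point \<open>(1 + r) / 2\<close> lies strictly between \<open>r\<close> and
    \<open>1\<close>: convergence there gives absolute convergence at \<open>r\<close>, hence the
    majorant.\<close>
  have sm: "summable (\<lambda>n. B * norm (a n * of_real r ^ n))"
  proof (intro summable_mult powser_insidea[where x = "of_real ((1 + r) / 2)"])
    show "summable (\<lambda>n. a n * of_real ((1 + r) / 2) ^ n)"
      using ps[of "of_real ((1 + r) / 2)"] r by (intro sums_summable) (auto simp: norm_of_real simp del: of_real_divide of_real_add)
  qed (use r in \<open>auto simp: norm_of_real simp del: of_real_divide of_real_add\<close>)
  have unif: "uniform_limit {0..2 * pi} (\<lambda>N t. \<Sum>i<N. h i t) (\<lambda>t. suminf (\<lambda>i. h i t)) sequentially"
    by (rule Weierstrass_m_test[OF _ sm])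
       (use r in \<open>auto simp: h_def norm_mult norm_power intro!: mult_right_mono B\<close>)
  have lim: "suminf (\<lambda>i. h i t) = of_real ((cmod (f (of_real r * cis t)))\<^sup>2)" for t
  proof (rule sums_unique[symmetric])
    have "(\<lambda>n. cnj (a n * (of_real r * cis t) ^ n)) sums cnj (f (of_real r * cis t))"
      using ps[of "of_real r * cis t"] r by (subst sums_cnj) (simp add: norm_mult)
    then have "(\<lambda>i. h i t) sums (f (of_real r * cis t) * cnj (f (of_real r * cis t)))"
      unfolding h_def by (rule sums_mult)
    then show "(\<lambda>i. h i t) sums of_real ((cmod (f (of_real r * cis t)))\<^sup>2)"
      by (simp only: complex_norm_square)
  qed
  obtain I J where I: "\<And>N. ((\<lambda>t. \<Sum>i<N. h i t) has_integral I N) {0..2 * pi}"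
    and J: "((\<lambda>t. of_real ((cmod (f (of_real r * cis t)))\<^sup>2)) has_integral J) {0..2 * pi}" and IJ: "I \<longlonglongrightarrow> J"
    by (rule uniform_limit_integral[OF unif[unfolded lim]]) (auto intro: continuous_intros hc)
  have hi: "(h i has_integral of_real (2 * pi * ((cmod (a i))\<^sup>2 * (r ^ i)\<^sup>2))) {0..2 * pi}" for i
  proof -
    have "((\<lambda>t. cnj (a i) * of_real r ^ i * (f (of_real r * cis t) * cnj (cis t ^ i))) has_integral
        cnj (a i) * of_real r ^ i * (2 * pi * (a i * r ^ i))) {0..2 * pi}"
      using taylor_coeff_integral[OF f r, of i] unfolding a_def of_real_power by (rule has_integral_mult_right)
    moreover have "cnj (a i) * of_real r ^ i * (2 * pi * (a i * r ^ i)) = of_real (2 * pi * ((cmod (a i))\<^sup>2 * (r ^ i)\<^sup>2))"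
      unfolding of_real_mult complex_norm_square by (simp add: power2_eq_square)
    moreover have "(\<lambda>t. cnj (a i) * of_real r ^ i * (f (of_real r * cis t) * cnj (cis t ^ i))) = h i"
      by (simp add: h_def fun_eq_iff power_mult_distrib)
    ultimately show ?thesis by metis
  qed
  have "I N = of_real (\<Sum>i<N. 2 * pi * ((cmod (a i))\<^sup>2 * (r ^ i)\<^sup>2))" for N
    unfolding of_real_sum by (rule has_integral_unique[OF I]) (intro has_integral_sum hi; simp)
  then have "(\<lambda>N. of_real (\<Sum>i<N. 2 * pi * ((cmod (a i))\<^sup>2 * (r ^ i)\<^sup>2)) :: complex) \<longlonglongrightarrow> J"
    using IJ by presburger
  then have "(\<lambda>N. \<Sum>i<N. 2 * pi * ((cmod (a i))\<^sup>2 * (r ^ i)\<^sup>2)) \<longlonglongrightarrow> Re J"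
    using tendsto_Re by fastforce
  moreover have "Re J = integral {0..2 * pi} (\<lambda>t. (cmod (f (of_real r * cis t)))\<^sup>2)"
    using has_integral_linear[OF J bounded_linear_Re] by (simp add: o_def integral_unique)
  ultimately show ?thesis unfolding sums_def a_def by simp
qed

section \<open>Hardy space bounds and approximation by dilations\<close>

lemma hardy2_iff:
  "f \<in> hardy2 \<longleftrightarrow> f holomorphic_on ball 0 1 \<and>
     (\<exists>M. \<forall>r\<in>{0..<1}. integral {0..2 * pi} (\<lambda>t. (cmod (f (of_real r * cis t)))\<^sup>2) \<le> M)"
proof -
  have "(LINT \<theta>:{0..2 * pi}|lebesgue. (cmod (f (of_real r * cis \<theta>)))\<^sup>2) =
        integral {0..2 * pi} (\<lambda>t. (cmod (f (of_real r * cis t)))\<^sup>2)"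
    if "f holomorphic_on ball 0 1" "r \<in> {0..<1}" for r
    by (intro set_lebesgue_integral_eq_integral absolutely_integrable_continuous_real continuous_intros
          continuous_on_circle_of_radius) (use that in auto)
  then have "(\<lambda>r. LINT \<theta>:{0..2 * pi}|lebesgue. (cmod (f (of_real r * cis \<theta>)))\<^sup>2) ` {0..<1} =
        (\<lambda>r. integral {0..2 * pi} (\<lambda>t. (cmod (f (of_real r * cis t)))\<^sup>2)) ` {0..<1}"
    if "f holomorphic_on ball 0 1"
    using that by (intro image_cong) auto
  moreover have "bdd_above (F ` A) \<longleftrightarrow> (\<exists>M. \<forall>x\<in>A. F x \<le> M)" for F :: "real \<Rightarrow> real" and A
    by (auto simp: bdd_above_def)
  ultimately show ?thesis
    unfolding hardy2_def mem_Collect_eq by (intro conj_cong) simp_all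
qed

lemma hardy2_bound:
  assumes f: "f \<in> hardy2"
  obtains M where "0 \<le> M" "\<And>r b. 0 \<le> r \<Longrightarrow> r < 1 \<Longrightarrow>
    integral {b..b + 2 * pi} (\<lambda>t. (cmod (f (of_real r * cis t)))\<^sup>2) \<le> M"
proof -
  obtain M where M: "\<And>r. r \<in> {0..<1} \<Longrightarrow> integral {0..2 * pi} (\<lambda>t. (cmod (f (of_real r * cis t)))\<^sup>2) \<le> M"
    and hol: "f holomorphic_on ball 0 1"
    using f unfolding hardy2_iff by blast
  have shift: "integral {b..b + 2 * pi} (\<lambda>t. (cmod (f (of_real r * cis t)))\<^sup>2) =
        integral {0..0 + 2 * pi} (\<lambda>t. (cmod (f (of_real r * cis t)))\<^sup>2)" if "r \<in> {0..<1}" for r b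
    by (rule integral_circle_shift, intro continuous_intros continuous_on_compose2[OF holomorphic_on_imp_continuous_on[OF hol]])
       (use that in \<open>auto simp: norm_mult intro!: continuous_intros\<close>)
  show thesis
  proof (rule that[of "\<bar>M\<bar>"])
    show "integral {b..b + 2 * pi} (\<lambda>t. (cmod (f (of_real r * cis t)))\<^sup>2) \<le> \<bar>M\<bar>" if "0 \<le> r" "r < 1" for r b
      using M[of r] shift[of r b] that by auto
  qed auto
qed

text \<open>Dilation multiplies the \<open>n\<close>-th Taylor coefficient by
  \<open>\<rho> ^ n\<close>, so by Parseval the error is a sum of
  \<open>b n * (1 - \<rho> ^ n)\<^sup>2\<close> with weights \<open>(r ^ n)\<^sup>2 \<le> 1\<close>.
  The tail is small because \<open>b\<close> is summable, the head for \<open>\<rho>\<close> close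
  to \<open>1\<close>; hence one \<open>\<rho>\<close> serves all \<open>r\<close>.\<close>

lemma hardy2_dilation_approx:
  assumes f: "f \<in> hardy2" and e: "0 < e"
  obtains \<rho> where "0 < \<rho>" "\<rho> < 1" "\<And>r. 0 < r \<Longrightarrow> r < 1 \<Longrightarrow>
    integral {0..2 * pi} (\<lambda>t. (cmod (f (of_real r * cis t) - f (of_real \<rho> * (of_real r * cis t))))\<^sup>2) \<le> e"
proof -
  have hol: "f holomorphic_on ball 0 1" using f by (simp add: hardy2_iff)
  obtain M where M: "0 \<le> M" "\<And>r. 0 \<le> r \<Longrightarrow> r < 1 \<Longrightarrow> integral {0..2 * pi} (\<lambda>t. (cmod (f (of_real r * cis t)))\<^sup>2) \<le> M"
    using hardy2_bound[OF f] by (metis add_0)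
  define b where "b n = 2 * pi * (cmod ((deriv ^^ n) f 0 / fact n))\<^sup>2" for n
  have b0: "0 \<le> b n" for n by (simp add: b_def)
  \<comment> \<open>A partial sum of the Parseval series is continuous in \<open>r\<close> up to
    \<open>1\<close>, so the bound, uniform in \<open>r\<close>, survives at
    \<open>r = 1\<close>.\<close>
  have part: "(\<Sum>n<N. b n) \<le> M" for N
  proof (rule tendsto_upperbound)
    show "((\<lambda>r. \<Sum>n<N. b n * (r ^ n)\<^sup>2) \<longlongrightarrow> (\<Sum>n<N. b n)) (at_left 1)"
    proof -
      have "((\<lambda>r. \<Sum>n<N. b n * (r ^ n)\<^sup>2) \<longlongrightarrow> (\<Sum>n<N. b n * (1 ^ n)\<^sup>2)) (at_left 1)"
        by (intro tendsto_intros)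
      then show ?thesis by simp
    qed
    have "(\<Sum>n<N. b n * (r ^ n)\<^sup>2) \<le> M" if r: "0 < r" "r < 1" for r
    proof -
      have "(\<lambda>n. b n * (r ^ n)\<^sup>2) sums integral {0..2 * pi} (\<lambda>t. (cmod (f (of_real r * cis t)))\<^sup>2)"
        using parseval_circle[OF hol r] by (simp add: b_def mult_ac)
      from sums_unique[OF this] sums_summable[OF this]
      have "(\<Sum>n<N. b n * (r ^ n)\<^sup>2) \<le> integral {0..2 * pi} (\<lambda>t. (cmod (f (of_real r * cis t)))\<^sup>2)"
        by (simp only:) (intro sum_le_suminf, auto simp: b0)
      also have "\<dots> \<le> M" using M r by simp
      finally show ?thesis .
    qed
    then show "\<forall>\<^sub>F r in at_left 1. (\<Sum>n<N. b n * (r ^ n)\<^sup>2) \<le> M"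
      by (auto simp: eventually_at_left_field intro!: exI[of _ "0::real"])
  qed auto
  have sb: "summable b"
    by (rule summableI_nonneg_bounded[of b M]) (use b0 part in auto)
  obtain N where N: "(\<Sum>n. b (n + N)) < e / 2"
    using suminf_exist_split[OF _ sb, of "e / 2"] e
    by (metis abs_less_iff half_gt_zero order_refl real_norm_def)
  have "((\<lambda>\<rho>. \<Sum>n<N. b n * (1 - \<rho> ^ n)\<^sup>2) \<longlongrightarrow> (\<Sum>n<N. b n * (1 - 1 ^ n)\<^sup>2)) (at_left 1)"
    by (intro tendsto_intros)
  then have "\<forall>\<^sub>F \<rho> in at_left 1. (\<Sum>n<N. b n * (1 - \<rho> ^ n)\<^sup>2) < e / 2"
    by (rule order_tendstoD) (use e in simp)
  moreover have "\<forall>\<^sub>F \<rho>::real in at_left 1. 0 < \<rho> \<and> \<rho> < 1"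
    by (auto simp: eventually_at_left_field intro!: exI[of _ "0::real"])
  ultimately have "\<forall>\<^sub>F \<rho> in at_left 1. (\<Sum>n<N. b n * (1 - \<rho> ^ n)\<^sup>2) < e / 2 \<and> 0 < \<rho> \<and> \<rho> < 1"
    by eventually_elim auto
  then obtain \<rho> where \<rho>: "(\<Sum>n<N. b n * (1 - \<rho> ^ n)\<^sup>2) < e / 2" "0 < \<rho>" "\<rho> < 1"
    using eventually_happens' trivial_limit_at_left_real by blast
  define g where "g z = f z - f (of_real \<rho> * z)" for z
  have *: "(\<lambda>z. f (of_real \<rho> * z)) holomorphic_on ball 0 1"
    using holomorphic_on_cball_dilation[of \<rho> f 1] \<rho> hol
    by (auto intro: holomorphic_on_subset[OF _ ball_subset_cball])
  then have g: "g holomorphic_on ball 0 1"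
    unfolding g_def by (intro holomorphic_intros hol)
  have coeff: "(deriv ^^ n) g 0 = (1 - of_real \<rho> ^ n) * (deriv ^^ n) f 0" for n
  proof -
    have "(deriv ^^ n) (\<lambda>z. f (of_real \<rho> * z)) 0 = of_real \<rho> ^ n * (deriv ^^ n) f (of_real \<rho> * 0)"
      by (rule higher_deriv_compose_linear[OF hol open_ball[of 0 1] open_ball]) (use \<rho> in \<open>auto simp: norm_mult intro: le_less_trans[OF mult_left_le_one_le]\<close>)
    then show ?thesis
      unfolding g_def by (subst higher_deriv_diff[OF hol *]) (auto simp: algebra_simps)
  qed
  have \<rho>n: "0 \<le> \<rho> ^ n" "\<rho> ^ n \<le> 1" for n using \<rho> by (auto simp: power_le_one)
  have "integral {0..2 * pi} (\<lambda>t. (cmod (g (of_real r * cis t)))\<^sup>2) \<le> e" if r: "0 < r" "r < 1" for r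
  proof -
    have "cmod (1 - of_real \<rho> ^ n) = 1 - \<rho> ^ n" for n
      using \<rho>n[of n] by (metis abs_of_nonneg diff_ge_0_iff_ge norm_of_real of_real_1 of_real_diff of_real_power)
    then have "2 * pi * ((cmod ((deriv ^^ n) g 0 / fact n))\<^sup>2 * (r ^ n)\<^sup>2) = b n * (1 - \<rho> ^ n)\<^sup>2 * (r ^ n)\<^sup>2" for n
      by (simp add: coeff b_def norm_mult norm_divide power_mult_distrib power_divide mult_ac)
    with parseval_circle[OF g r]
    have sums: "(\<lambda>n. b n * (1 - \<rho> ^ n)\<^sup>2 * (r ^ n)\<^sup>2) sums integral {0..2 * pi} (\<lambda>t. (cmod (g (of_real r * cis t)))\<^sup>2)"
      by simp
    have le1: "b n * (1 - \<rho> ^ n)\<^sup>2 * (r ^ n)\<^sup>2 \<le> b n * (1 - \<rho> ^ n)\<^sup>2" for n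
      using r by (intro mult_right_le_one_le) (auto simp: b0 power_le_one power2_eq_square mult_le_one)
    have le2: "b n * (1 - \<rho> ^ n)\<^sup>2 \<le> b n" for n
      using \<rho>n[of n] by (intro mult_right_le_one_le) (auto simp: b0 power2_eq_square mult_le_one)
    have sm: "summable (\<lambda>n. b n * (1 - \<rho> ^ n)\<^sup>2)"
      by (rule summable_comparison_test'[OF sb, of 0]) (use le2 b0 in auto)
    have "integral {0..2 * pi} (\<lambda>t. (cmod (g (of_real r * cis t)))\<^sup>2) \<le> (\<Sum>n. b n * (1 - \<rho> ^ n)\<^sup>2)"
      using sums_le[OF _ sums summable_sums[OF sm]] le1 by blast
    also have "\<dots> = (\<Sum>n. b (n + N) * (1 - \<rho> ^ (n + N))\<^sup>2) + (\<Sum>n<N. b n * (1 - \<rho> ^ n)\<^sup>2)"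
      by (rule suminf_split_initial_segment[OF sm])
    also have "(\<Sum>n. b (n + N) * (1 - \<rho> ^ (n + N))\<^sup>2) \<le> (\<Sum>n. b (n + N))"
      by (rule suminf_le) (use le2 summable_ignore_initial_segment[OF sb] summable_ignore_initial_segment[OF sm] in auto)
    finally show ?thesis using N \<rho>(1) by simp
  qed
  then show thesis using that[OF \<rho>(2,3)] by (simp add: g_def)
qed

text \<open>Cauchy's criterion with countably many tolerances, so that the set of divergence becomes
  a countable union. The \<open>3\<close> prepares for a splitting into three equal errors.\<close>

lemma at_left_cauchy_convergent:
  fixes h :: "real \<Rightarrow> complex"
  assumes "\<And>n::nat. \<exists>\<delta><1. \<forall>r s. \<delta> < r \<longrightarrow> r < 1 \<longrightarrow> \<delta> < s \<longrightarrow> s < 1 \<longrightarrow> dist (h r) (h s) \<le> 3 / real (Suc n)"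
  shows "\<exists>l. (h \<longlongrightarrow> l) (at_left 1)"
proof -
  have "\<exists>P. eventually P (at_left 1) \<and> (\<forall>x y. P x \<and> P y \<longrightarrow> dist (h x) (h y) < e)" if e: "0 < e" for e
  proof -
    obtain n where n: "3 / real (Suc n) < e"
      using reals_Archimedean[of "e / 3"] e by (auto simp: field_simps)
    obtain \<delta> where "\<delta> < 1" "\<And>r s. \<delta> < r \<Longrightarrow> r < 1 \<Longrightarrow> \<delta> < s \<Longrightarrow> s < 1 \<Longrightarrow> dist (h r) (h s) \<le> 3 / real (Suc n)"
      using assms[of n] by blast
    then show ?thesis
      using n by (intro exI[of _ "\<lambda>r. \<delta> < r \<and> r < 1"]) (force simp: eventually_at_left_field)
  qed
  then have "cauchy_filter (filtermap h (at_left 1))"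
    unfolding cauchy_filter_metric_filtermap by blast
  then show ?thesis
    by (metis cauchy_filter_convergent convergent_filter_iff filterlim_def trivial_limit_at_left_real filtermap_bot_iff)
qed

text \<open>Split \<open>f\<close> into a dilation, continuous up to the boundary, and a remainder
  \<open>g\<close> of small mean square. Large radial oscillation of \<open>f\<close> near
  \<open>1\<close> must come from \<open>g\<close>, and the weak type bound makes the set of such
  angles as small as desired.\<close>

lemma negligible_no_radial_limit_interval:
  assumes f: "f \<in> hardy2"
  shows "negligible ({0..2 * pi} \<inter> {\<theta>. \<nexists>l. ((\<lambda>r. f (of_real r * cis \<theta>)) \<longlongrightarrow> l) (at_left 1)})"
proof -
  have hol: "f holomorphic_on ball 0 1" using f by (simp add: hardy2_iff)
  define B where "B n = {\<theta> \<in> {0..2 * pi}. \<forall>\<delta><1. \<exists>r s. \<delta> < r \<and> r < 1 \<and> \<delta> < s \<and> s < 1 \<and>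
     3 / real (Suc n) < dist (f (of_real r * cis \<theta>)) (f (of_real s * cis \<theta>))}" for n
  have "negligible (B n)" for n
    unfolding negligible_outer_le
  proof (intro allI impI)
    fix e :: real assume e: "0 < e"
    \<comment> \<open>The maximal estimate concerns squared moduli, hence the square; a mean square
      error of at most \<open>e * l / 10\<close> then yields measure at most
      \<open>e\<close>.\<close>
    define l where "l = 1 / (real (Suc n))\<^sup>2"
    have l: "0 < l" by (simp add: l_def)
    obtain \<rho> where \<rho>: "0 < \<rho>" "\<rho> < 1" and le: "\<And>r. 0 < r \<Longrightarrow> r < 1 \<Longrightarrow>
      integral {0..2 * pi} (\<lambda>t. (cmod (f (of_real r * cis t) - f (of_real \<rho> * (of_real r * cis t))))\<^sup>2) \<le> e * l / 10"
      using hardy2_dilation_approx[OF f, of "e * l / 10"] e l by auto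
    define g where "g z = f z - f (of_real \<rho> * z)" for z
    have dil: "(\<lambda>z. f (of_real \<rho> * z)) holomorphic_on cball 0 1"
      using holomorphic_on_cball_dilation[of \<rho> f 1] \<rho> hol by simp
    have g: "g holomorphic_on ball 0 1"
      unfolding g_def by (intro holomorphic_intros hol holomorphic_on_subset[OF dil]) auto
    define S where "S = {\<theta> \<in> {0..0 + 2 * pi}. \<exists>r\<in>{0..<1}. (cmod (g (of_real r * cis \<theta>)))\<^sup>2 > l}"
    have "integral {b..b + 2 * pi} (\<lambda>t. (cmod (g (of_real r * cis t)))\<^sup>2) \<le> e * l / 10"
      if r: "0 < r" "r < 1" for r b
    proof -
      have "integral {b..b + 2 * pi} (\<lambda>t. (cmod (g (of_real r * cis t)))\<^sup>2) =
            integral {0..0 + 2 * pi} (\<lambda>t. (cmod (g (of_real r * cis t)))\<^sup>2)"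
        by (rule integral_circle_shift, intro continuous_intros continuous_on_compose2[OF holomorphic_on_imp_continuous_on[OF g]])
           (use r in \<open>auto simp: norm_mult intro!: continuous_intros\<close>)
      then show ?thesis using le[OF r] by (simp add: g_def)
    qed
    from radial_maximal_weak_type[OF g l this, of 0]
    have S: "S \<in> lmeasurable" "measure lebesgue S \<le> e"
      using l by (auto simp: S_def)
    have "B n \<subseteq> S"
    proof
      fix \<theta> assume \<theta>: "\<theta> \<in> B n"
      have "isCont (\<lambda>r. f (of_real \<rho> * (of_real r * cis \<theta>))) 1"
      proof -
        have "isCont f (of_real \<rho> * (of_real 1 * cis \<theta>))"
          using holomorphic_on_imp_continuous_on[OF hol] \<rho>
          by (intro continuous_on_interior[of "ball 0 1"]) (auto simp: norm_mult)
        then show ?thesis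
          by (intro isCont_o2[where g = f and f = "\<lambda>r. of_real \<rho> * (of_real r * cis \<theta>)"] continuous_intros) auto
      qed
      then obtain d where d: "0 < d" "\<And>r. \<bar>r - 1\<bar> < d \<Longrightarrow>
          dist (f (of_real \<rho> * (of_real r * cis \<theta>))) (f (of_real \<rho> * (of_real 1 * cis \<theta>))) < 1 / (2 * real (Suc n))"
        unfolding continuous_at_eps_delta
        by (metis dist_real_def of_nat_0_less_iff zero_less_Suc zero_less_divide_1_iff zero_less_mult_iff zero_less_numeral)
      have "max 0 (1 - d) < 1" using d by simp
      then obtain r s where rs: "max 0 (1 - d) < r" "r < 1" "max 0 (1 - d) < s" "s < 1"
         "3 / real (Suc n) < dist (f (of_real r * cis \<theta>)) (f (of_real s * cis \<theta>))"
        using \<theta> unfolding B_def by blast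
      have small: "dist (f (of_real \<rho> * (of_real r * cis \<theta>))) (f (of_real \<rho> * (of_real s * cis \<theta>))) < 1 / real (Suc n)"
      proof -
        have "dist (f (of_real \<rho> * (of_real r * cis \<theta>))) (f (of_real \<rho> * (of_real s * cis \<theta>))) <
           1 / (2 * real (Suc n)) + 1 / (2 * real (Suc n))"
          by (rule dist_triangle_less_add[OF d(2) d(2)]) (use rs in auto)
        then show ?thesis by (simp add: field_simps)
      qed
      have "f (of_real r * cis \<theta>) - f (of_real s * cis \<theta>) =
         g (of_real r * cis \<theta>) - g (of_real s * cis \<theta>) +
         (f (of_real \<rho> * (of_real r * cis \<theta>)) - f (of_real \<rho> * (of_real s * cis \<theta>)))"
        by (simp add: g_def)
      then have "dist (f (of_real r * cis \<theta>)) (f (of_real s * cis \<theta>)) \<le>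
         cmod (g (of_real r * cis \<theta>)) + cmod (g (of_real s * cis \<theta>)) +
         dist (f (of_real \<rho> * (of_real r * cis \<theta>))) (f (of_real \<rho> * (of_real s * cis \<theta>)))"
        unfolding dist_norm by (metis (no_types, opaque_lifting) norm_triangle_le norm_triangle_ineq4 add_right_mono)
      moreover have "3 / real (Suc n) = 1 / real (Suc n) + 1 / real (Suc n) + 1 / real (Suc n)" by simp
      \<comment> \<open>The total exceeds three shares and the dilated part takes less than one, so
        one of the two values of \<open>g\<close> exceeds its share.\<close>
      ultimately have "1 / real (Suc n) < cmod (g (of_real r * cis \<theta>)) \<or> 1 / real (Suc n) < cmod (g (of_real s * cis \<theta>))"
        using rs(5) small by linarith
      moreover have "l < (cmod z)\<^sup>2" if "1 / real (Suc n) < cmod z" for z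
        using power_strict_mono[OF that, of 2] by (simp add: l_def power_divide)
      ultimately show "\<theta> \<in> S"
        using rs(1-4) \<theta> by (fastforce simp: S_def B_def)
    qed
    then show "\<exists>T. B n \<subseteq> T \<and> T \<in> lmeasurable \<and> measure lebesgue T \<le> e" using S by blast
  qed
  then have "negligible (\<Union>n. B n)" by (intro negligible_Union_nat)
  moreover have "{0..2 * pi} \<inter> {\<theta>. \<nexists>l. ((\<lambda>r. f (of_real r * cis \<theta>)) \<longlongrightarrow> l) (at_left 1)} \<subseteq> (\<Union>n. B n)"
  proof
    fix \<theta> assume \<theta>: "\<theta> \<in> {0..2 * pi} \<inter> {\<theta>. \<nexists>l. ((\<lambda>r. f (of_real r * cis \<theta>)) \<longlongrightarrow> l) (at_left 1)}"
    then have "\<exists>n. \<not> (\<exists>\<delta><1. \<forall>r s. \<delta> < r \<longrightarrow> r < 1 \<longrightarrow> \<delta> < s \<longrightarrow> s < 1 \<longrightarrow>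
        dist (f (of_real r * cis \<theta>)) (f (of_real s * cis \<theta>)) \<le> 3 / real (Suc n))"
      using at_left_cauchy_convergent[of "\<lambda>r. f (of_real r * cis \<theta>)"] by blast
    then obtain n where "\<not> (\<exists>\<delta><1. \<forall>r s. \<delta> < r \<longrightarrow> r < 1 \<longrightarrow> \<delta> < s \<longrightarrow> s < 1 \<longrightarrow>
        dist (f (of_real r * cis \<theta>)) (f (of_real s * cis \<theta>)) \<le> 3 / real (Suc n))" ..
    then have "\<theta> \<in> B n" using \<theta> unfolding B_def not_le[symmetric] by blast
    then show "\<theta> \<in> (\<Union>n. B n)" by blast
  qed
  ultimately show ?thesis by (rule negligible_subset)
qed

theorem fatou_radial_limits:
  assumes f: "f \<in> hardy2"
  shows "negligible {\<theta>. \<nexists>l. ((\<lambda>r. f (of_real r * cis \<theta>)) \<longlongrightarrow> l) (at_left 1)}"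
proof -
  define E where "E = {\<theta>. \<nexists>l. ((\<lambda>r. f (of_real r * cis \<theta>)) \<longlongrightarrow> l) (at_left 1)}"
  have per: "\<theta> - 2 * pi * of_int k \<in> E \<longleftrightarrow> \<theta> \<in> E" for \<theta> k
  proof -
    have "cis (\<theta> - 2 * pi * of_int k) = cis \<theta>"
      by (simp flip: cis_divide)
    then show ?thesis by (simp add: E_def)
  qed
  have "negligible ((+) (2 * pi * of_int k) ` ({0..2 * pi} \<inter> E))" for k :: int
    using negligible_no_radial_limit_interval[OF f] unfolding E_def by (rule negligible_translation)
  then have "negligible (\<Union>k::int. (+) (2 * pi * of_int k) ` ({0..2 * pi} \<inter> E))"
    by (intro negligible_countable_Union) auto
  moreover have "E \<subseteq> (\<Union>k::int. (+) (2 * pi * of_int k) ` ({0..2 * pi} \<inter> E))"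
  proof
    fix \<theta> assume \<theta>: "\<theta> \<in> E"
    define k where "k = \<lfloor>\<theta> / (2 * pi)\<rfloor>"
    have "of_int k \<le> \<theta> / (2 * pi)" "\<theta> / (2 * pi) < of_int k + 1" unfolding k_def by linarith+
    then have "2 * pi * of_int k \<le> \<theta>" "\<theta> \<le> 2 * pi * of_int k + 2 * pi" by (simp_all add: field_simps)
    then have "\<theta> - 2 * pi * of_int k \<in> {0..2 * pi} \<inter> E" using per \<theta> by simp
    then show "\<theta> \<in> (\<Union>k::int. (+) (2 * pi * of_int k) ` ({0..2 * pi} \<inter> E))"
      by (intro UN_I[of k] image_eqI[where x = "\<theta> - 2 * pi * of_int k"]) auto
  qed
  ultimately show ?thesis unfolding E_def by (rule negligible_subset)
qed

section \<open>Measurability and integrability of the boundary function\<close>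

lemma radial_limitI:
  "((\<lambda>r. f (of_real r * \<xi>)) \<longlongrightarrow> l) (at_left 1) \<Longrightarrow> radial_limit f \<xi> = l"
  unfolding radial_limit_def by (rule tendsto_Lim) simp_all

lemma hardy2_AE_radial_limit:
  assumes "f \<in> hardy2"
  shows "AE \<theta> in lebesgue. ((\<lambda>r. f (of_real r * cis \<theta>)) \<longlongrightarrow> radial_limit f (cis \<theta>)) (at_left 1)"
proof -
  have "{\<theta>. \<nexists>l. ((\<lambda>r. f (of_real r * cis \<theta>)) \<longlongrightarrow> l) (at_left 1)} \<in> null_sets lebesgue"
    using fatou_radial_limits[OF assms] by (simp add: negligible_iff_null_sets)
  from AE_not_in[OF this] show ?thesis
    by eventually_elim (auto dest: radial_limitI)
qed

lemma radius_sequence: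
  obtains c :: "nat \<Rightarrow> real" where "\<And>n. 0 < c n" "\<And>n. c n < 1" "filterlim c (at_left 1) sequentially"
proof (rule that[of "\<lambda>n. 1 - 1 / real (n + 2)"])
  show pos: "0 < 1 - 1 / real (n + 2)" and less: "1 - 1 / real (n + 2) < 1" for n
    by (auto simp: field_simps)
  have "(\<lambda>n. 1 - 1 / real (n + 2)) \<longlonglongrightarrow> 1 - 0"
    by (intro tendsto_diff tendsto_const LIMSEQ_ignore_initial_segment lim_1_over_n)
  then show "filterlim (\<lambda>n. 1 - 1 / real (n + 2)) (at_left 1) sequentially"
    using less by (simp add: filterlim_at)
qed

lemma radial_limit_measurable:
  assumes f: "f \<in> hardy2"
  shows "(\<lambda>\<theta>. radial_limit f (cis \<theta>)) \<in> borel_measurable lebesgue"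
proof -
  have hol: "f holomorphic_on ball 0 1" using f by (simp add: hardy2_iff)
  define N where "N = {\<theta>. \<nexists>l. ((\<lambda>r. f (of_real r * cis \<theta>)) \<longlongrightarrow> l) (at_left 1)}"
  have N: "N \<in> sets lebesgue"
    unfolding N_def using fatou_radial_limits[OF f] by (simp add: negligible_imp_sets)
  obtain c where c: "\<And>n. 0 < c n" "\<And>n. c n < 1" "filterlim c (at_left (1::real)) sequentially"
    using radius_sequence by blast
  \<comment> \<open>On \<open>N\<close> no limit exists, so \<open>Lim\<close> unfolds to a
    description without witness, the same constant for all angles. Setting the approximants to
    \<open>k\<close> on \<open>N\<close> makes them converge everywhere.\<close>
  define k where "k = (THE l::complex. False)"
  have k: "radial_limit f (cis \<theta>) = k" if "\<theta> \<in> N" for \<theta>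
    using that unfolding N_def radial_limit_def Topological_Spaces.Lim_def k_def by simp
  show ?thesis
  proof (rule borel_measurable_LIMSEQ_metric)
    show "(\<lambda>\<theta>. if \<theta> \<in> N then k else f (of_real (c n) * cis \<theta>)) \<in> borel_measurable lebesgue" for n
    proof (rule measurable_If_set)
      have "continuous_on UNIV (\<lambda>\<theta>. f (of_real (c n) * cis \<theta>))"
        by (rule continuous_on_circle_of_radius[OF hol]) (use c less_imp_le in auto)
      then show "(\<lambda>\<theta>. f (of_real (c n) * cis \<theta>)) \<in> borel_measurable lebesgue"
        using borel_measurable_continuous_onI by (intro measurable_completion) simp
    qed (use N in auto)
    show "(\<lambda>n. if \<theta> \<in> N then k else f (of_real (c n) * cis \<theta>)) \<longlonglongrightarrow> radial_limit f (cis \<theta>)" for \<theta>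
    proof (cases "\<theta> \<in> N")
      case False
      then have "((\<lambda>r. f (of_real r * cis \<theta>)) \<longlongrightarrow> radial_limit f (cis \<theta>)) (at_left 1)"
        unfolding N_def using radial_limitI by fastforce
      then show ?thesis
        using False filterlim_compose[OF _ c(3)] by fastforce
    qed (simp add: k)
  qed
qed

text \<open>Fatou's lemma along a sequence of radii; \<open>x \<le> 1 + x\<^sup>2\<close> passes
  from the square means, bounded by the Hardy condition, to means of the modulus.\<close>

lemma radial_limit_integrable:
  assumes f: "f \<in> hardy2" and ab: "b \<le> a + 2 * pi"
  shows "set_integrable lebesgue {a..b} (\<lambda>\<theta>. radial_limit f (cis \<theta>))"
proof -
  have hol: "f holomorphic_on ball 0 1" using f by (simp add: hardy2_iff)
  obtain c where c: "\<And>n. 0 < c n" "\<And>n. c n < 1" "filterlim c (at_left (1::real)) sequentially"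
    using radius_sequence by blast
  obtain M where M: "0 \<le> M" "\<And>r b. 0 \<le> r \<Longrightarrow> r < 1 \<Longrightarrow>
      integral {b..b + 2 * pi} (\<lambda>t. (cmod (f (of_real r * cis t)))\<^sup>2) \<le> M"
    using hardy2_bound[OF f] by metis
  define u where "u n \<theta> = ennreal (norm (indicator {a..b} \<theta> *\<^sub>R f (of_real (c n) * cis \<theta>)))" for n \<theta>
  have cont: "continuous_on A (\<lambda>\<theta>. f (of_real (c n) * cis \<theta>))" for n A
    by (rule continuous_on_circle_of_radius[OF hol]) (use c less_imp_le in auto)
  have i: "(indicator {a..b} :: real \<Rightarrow> real) \<in> borel_measurable lebesgue"
    by (rule borel_measurable_indicator) simp
  have um: "u n \<in> borel_measurable lebesgue" for n
  proof -
    have m: "(\<lambda>\<theta>. f (of_real (c n) * cis \<theta>)) \<in> borel_measurable lebesgue"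
      using borel_measurable_continuous_onI[OF cont[of UNIV n]] by (intro measurable_completion) simp
    show ?thesis
      unfolding u_def
      by (rule measurable_compose[OF measurable_compose[OF borel_measurable_scaleR[OF i m] borel_measurable_norm] measurable_ennreal])
  qed
  have ub: "(\<integral>\<^sup>+ \<theta>. u n \<theta> \<partial>lebesgue) \<le> ennreal (2 * pi + M)" for n
  proof -
    have "(\<integral>\<^sup>+ \<theta>. u n \<theta> \<partial>lebesgue) \<le>
       (\<integral>\<^sup>+ \<theta>. ennreal (indicator {a..a + 2 * pi} \<theta> * (1 + (cmod (f (of_real (c n) * cis \<theta>)))\<^sup>2)) \<partial>lebesgue)"
    proof (rule nn_integral_mono)
      fix \<theta>
      have "x \<le> 1 + x\<^sup>2" for x :: real
        using zero_le_power2[of "x - 1"] zero_le_power2[of x] unfolding power2_diff one_power2 by linarith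
      then show "u n \<theta> \<le> ennreal (indicator {a..a + 2 * pi} \<theta> * (1 + (cmod (f (of_real (c n) * cis \<theta>)))\<^sup>2))"
        using ab by (auto simp: u_def indicator_def intro!: ennreal_leI)
    qed
    also have "\<dots> = ennreal (integral {a..a + 2 * pi} (\<lambda>\<theta>. 1 + (cmod (f (of_real (c n) * cis \<theta>)))\<^sup>2))"
    proof -
      have si: "set_integrable lebesgue {a..a + 2 * pi} (\<lambda>\<theta>. 1 + (cmod (f (of_real (c n) * cis \<theta>)))\<^sup>2)"
        by (intro absolutely_integrable_continuous_real continuous_intros cont)
      show ?thesis
        unfolding set_lebesgue_integral_eq_integral(2)[OF si, symmetric] set_lebesgue_integral_def
        using si[unfolded set_integrable_def]
        by (subst nn_integral_eq_integral[symmetric]) auto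
    qed
    also have "integral {a..a + 2 * pi} (\<lambda>\<theta>. 1 + (cmod (f (of_real (c n) * cis \<theta>)))\<^sup>2) =
        2 * pi + integral {a..a + 2 * pi} (\<lambda>\<theta>. (cmod (f (of_real (c n) * cis \<theta>)))\<^sup>2)"
      by (subst integral_add) (auto intro!: integrable_continuous_real continuous_intros cont)
    also have "\<dots> \<le> 2 * pi + M"
      using M(2)[of "c n" a] c less_imp_le by auto
    finally show ?thesis by (simp add: ennreal_leI)
  qed
  have "(\<integral>\<^sup>+ \<theta>. ennreal (norm (indicator {a..b} \<theta> *\<^sub>R radial_limit f (cis \<theta>))) \<partial>lebesgue) =
        (\<integral>\<^sup>+ \<theta>. liminf (\<lambda>n. u n \<theta>) \<partial>lebesgue)"
  proof (rule nn_integral_cong_AE)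
    show "AE \<theta> in lebesgue. ennreal (norm (indicator {a..b} \<theta> *\<^sub>R radial_limit f (cis \<theta>))) = liminf (\<lambda>n. u n \<theta>)"
      using hardy2_AE_radial_limit[OF f]
    proof eventually_elim
      case (elim \<theta>)
      have "(\<lambda>n. f (of_real (c n) * cis \<theta>)) \<longlonglongrightarrow> radial_limit f (cis \<theta>)"
        using filterlim_compose[OF elim c(3)] .
      then have "(\<lambda>n. u n \<theta>) \<longlonglongrightarrow> ennreal (norm (indicator {a..b} \<theta> *\<^sub>R radial_limit f (cis \<theta>)))"
        unfolding u_def by (intro tendsto_intros)
      then show ?case by (simp add: lim_imp_Liminf)
    qed
  qed
  also have "\<dots> \<le> liminf (\<lambda>n. \<integral>\<^sup>+ \<theta>. u n \<theta> \<partial>lebesgue)"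
    by (rule nn_integral_liminf[OF um])
  also have "\<dots> \<le> ennreal (2 * pi + M)"
    using ub by (intro Liminf_le) auto
  also have "\<dots> < \<infinity>" by simp
  finally show ?thesis
    unfolding set_integrable_def
    by (intro integrableI_bounded borel_measurable_scaleR[OF i] radial_limit_measurable[OF f])
qed

section \<open>Affine superposition\<close>

lemma hardy2_affine:
  assumes f: "f \<in> hardy2"
  shows "(\<lambda>z. a * f z + b) \<in> hardy2"
proof -
  have hol: "f holomorphic_on ball 0 1" using f by (simp add: hardy2_iff)
  obtain M where M: "\<And>r. r \<in> {0..<1} \<Longrightarrow> integral {0..2 * pi} (\<lambda>t. (cmod (f (of_real r * cis t)))\<^sup>2) \<le> M"
    using f unfolding hardy2_iff by blast
  have "integral {0..2 * pi} (\<lambda>t. (cmod (a * f (of_real r * cis t) + b))\<^sup>2) \<le> 2 * (cmod a)\<^sup>2 * M + 2 * (cmod b)\<^sup>2 * (2 * pi)"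
    if r: "r \<in> {0..<1}" for r
  proof -
    have cont: "continuous_on A (\<lambda>t. f (of_real r * cis t))" for A
      by (rule continuous_on_circle_of_radius[OF hol]) (use r in auto)
    have "integral {0..2 * pi} (\<lambda>t. (cmod (a * f (of_real r * cis t) + b))\<^sup>2) \<le>
       integral {0..2 * pi} (\<lambda>t. 2 * (cmod a)\<^sup>2 * (cmod (f (of_real r * cis t)))\<^sup>2 + 2 * (cmod b)\<^sup>2)"
    proof (rule integral_le)
      fix t
      have "(cmod (a * w + b))\<^sup>2 \<le> 2 * (cmod a)\<^sup>2 * (cmod w)\<^sup>2 + 2 * (cmod b)\<^sup>2" for w
      proof -
        have "(cmod (a * w + b))\<^sup>2 \<le> (cmod (a * w) + cmod b)\<^sup>2"
          by (intro power_mono norm_triangle_ineq) auto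
        also have "\<dots> \<le> 2 * (cmod (a * w))\<^sup>2 + 2 * (cmod b)\<^sup>2"
          using zero_le_power2[of "cmod (a * w) - cmod b"] by (simp add: power2_diff power2_sum)
        finally show ?thesis by (simp add: norm_mult power_mult_distrib)
      qed
      then show "(cmod (a * f (of_real r * cis t) + b))\<^sup>2 \<le> 2 * (cmod a)\<^sup>2 * (cmod (f (of_real r * cis t)))\<^sup>2 + 2 * (cmod b)\<^sup>2" .
    qed (auto intro!: integrable_continuous_real continuous_intros cont)
    also have "\<dots> = 2 * (cmod a)\<^sup>2 * integral {0..2 * pi} (\<lambda>t. (cmod (f (of_real r * cis t)))\<^sup>2) + 2 * (cmod b)\<^sup>2 * (2 * pi)"
      by (subst integral_add) (auto intro!: integrable_continuous_real continuous_intros cont)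
    also have "\<dots> \<le> 2 * (cmod a)\<^sup>2 * M + 2 * (cmod b)\<^sup>2 * (2 * pi)"
      using M[OF r] by (intro add_mono mult_left_mono) auto
    finally show ?thesis .
  qed
  moreover have "(\<lambda>z. a * f z + b) holomorphic_on ball 0 1"
    by (intro holomorphic_intros hol)
  ultimately show ?thesis unfolding hardy2_iff by blast
qed

lemma arc_length_eq: "(\<alpha>, \<beta>) \<in> arcs \<Longrightarrow> arc_length (\<alpha>, \<beta>) = (\<beta> - \<alpha>) / (2 * pi)"
  by (simp add: arcs_def arc_length_def arc_integral_def set_integral_const)

lemma arc_oscillation_nonneg: "0 \<le> arc_oscillation p f I"
  unfolding arc_oscillation_def arc_integral_def set_lebesgue_integral_def
  by (intro mult_nonneg_nonneg Bochner_Integration.integral_nonneg) auto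

text \<open>Affine maps commute with radial limits where these exist, which is almost everywhere by
  Fatou's theorem. Integrability of the boundary function then makes the arc mean affine as well,
  and the constant \<open>b\<close> cancels.\<close>

lemma arc_oscillation_affine:
  assumes f: "f \<in> hardy2" and I: "I \<in> arcs"
  shows "arc_oscillation p (\<lambda>z. a * f z + b) I = (cmod a)\<^sup>2 * arc_oscillation p f I"
proof -
  obtain \<alpha> \<beta> where I_eq: "I = (\<alpha>, \<beta>)" and ab: "\<alpha> < \<beta>" "\<beta> \<le> \<alpha> + 2 * pi"
    using I by (auto simp: arcs_def)
  define F where "F \<theta> = radial_limit f (cis \<theta>)" for \<theta>
  define G where "G \<theta> = radial_limit (\<lambda>z. a * f z + b) (cis \<theta>)" for \<theta>
  have Fm[measurable]: "F \<in> borel_measurable lebesgue"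
    unfolding F_def by (rule radial_limit_measurable[OF f])
  have Gm[measurable]: "G \<in> borel_measurable lebesgue"
    unfolding G_def by (rule radial_limit_measurable[OF hardy2_affine[OF f]])
  have Fi: "set_integrable lebesgue {\<alpha>..\<beta>} F"
    unfolding F_def by (rule radial_limit_integrable[OF f ab(2)])
  have AE: "AE \<theta> in lebesgue. G \<theta> = a * F \<theta> + b"
    using hardy2_AE_radial_limit[OF f]
    by eventually_elim (auto simp: F_def G_def intro!: radial_limitI tendsto_intros)
  define m where "m = arc_mean I (radial_limit f)"
  have len: "2 * pi * arc_length I = \<beta> - \<alpha>"
    using arc_length_eq I unfolding I_eq by simp
  have "arc_integral I (radial_limit (\<lambda>z. a * f z + b)) = (LINT \<theta>:{\<alpha>..\<beta>}|lebesgue. a * F \<theta> + b)"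
    unfolding arc_integral_def I_eq fst_conv snd_conv G_def[symmetric]
    by (rule set_lebesgue_integral_cong_AE) (use AE in auto)
  also have "\<dots> = a * (LINT \<theta>:{\<alpha>..\<beta>}|lebesgue. F \<theta>) + of_real (\<beta> - \<alpha>) * b"
  proof (subst set_integral_add)
    show "set_integrable lebesgue {\<alpha>..\<beta>} (\<lambda>\<theta>. a * F \<theta>)" using Fi by (rule set_integrable_mult_right)
    show "set_integrable lebesgue {\<alpha>..\<beta>} (\<lambda>\<theta>. b)"
      by (rule absolutely_integrable_continuous_real) simp
    show "(LINT \<theta>:{\<alpha>..\<beta>}|lebesgue. a * F \<theta>) + (LINT \<theta>:{\<alpha>..\<beta>}|lebesgue. b) =
      a * (LINT \<theta>:{\<alpha>..\<beta>}|lebesgue. F \<theta>) + of_real (\<beta> - \<alpha>) * b"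
      using ab by (simp add: set_integral_const scaleR_conv_of_real)
  qed
  finally have mean: "arc_mean I (radial_limit (\<lambda>z. a * f z + b)) = a * m + b"
    using ab unfolding m_def arc_mean_def len unfolding arc_integral_def I_eq fst_conv snd_conv F_def
    by (simp add: field_simps)
  have "arc_integral I (\<lambda>\<xi>. (cmod (radial_limit (\<lambda>z. a * f z + b) \<xi> - (a * m + b)))\<^sup>2) =
      (LINT \<theta>:{\<alpha>..\<beta>}|lebesgue. (cmod a)\<^sup>2 * (cmod (F \<theta> - m))\<^sup>2)"
    unfolding arc_integral_def I_eq fst_conv snd_conv G_def[symmetric]
  proof (rule set_lebesgue_integral_cong_AE)
    have "a * F \<theta> + b - (a * m + b) = a * (F \<theta> - m)" for \<theta> by (simp add: algebra_simps)
    then show "AE \<theta>\<in>{\<alpha>..\<beta>} in lebesgue. (cmod (G \<theta> - (a * m + b)))\<^sup>2 = (cmod a)\<^sup>2 * (cmod (F \<theta> - m))\<^sup>2"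
      using AE by (auto simp: norm_mult power_mult_distrib)
  qed auto
  also have "\<dots> = (cmod a)\<^sup>2 * arc_integral I (\<lambda>\<xi>. (cmod (radial_limit f \<xi> - m))\<^sup>2)"
    unfolding arc_integral_def I_eq fst_conv snd_conv F_def by simp
  finally show ?thesis
    unfolding arc_oscillation_def mean m_def[symmetric] by simp
qed

lemma CA_seminorm_upper:
  assumes "f \<in> CA p" "I \<in> arcs"
  shows "sqrt (arc_oscillation p f I) \<le> CA_seminorm p f"
  unfolding CA_seminorm_def using assms by (intro cSUP_upper) (auto simp: CA_def)

lemma circle_in_arcs: "(0, 2 * pi) \<in> arcs"
  by (simp add: arcs_def)

lemma CA_seminorm_least:
  assumes "\<And>I. I \<in> arcs \<Longrightarrow> sqrt (arc_oscillation p f I) \<le> B"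
  shows "CA_seminorm p f \<le> B"
  unfolding CA_seminorm_def using circle_in_arcs assms by (intro cSUP_least) auto

lemma CA_affine:
  assumes f: "f \<in> CA p"
  shows "(\<lambda>z. a * f z + b) \<in> CA p"
    and "CA_norm p (\<lambda>z. a * f z + b) \<le> cmod a * CA_norm p f + cmod b"
proof -
  have h: "f \<in> hardy2" using f by (simp add: CA_def)
  have le: "sqrt (arc_oscillation p (\<lambda>z. a * f z + b) I) \<le> cmod a * CA_seminorm p f" if "I \<in> arcs" for I
    using CA_seminorm_upper[OF f that] arc_oscillation_affine[OF h that]
    by (simp add: real_sqrt_mult mult_left_mono)
  then have "bdd_above ((\<lambda>I. sqrt (arc_oscillation p (\<lambda>z. a * f z + b) I)) ` arcs)"
    by (intro bdd_aboveI2)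
  then show "(\<lambda>z. a * f z + b) \<in> CA p"
    using hardy2_affine[OF h] by (simp add: CA_def)
  have "cmod (a * f 0 + b) \<le> cmod a * cmod (f 0) + cmod b"
    by (metis norm_mult norm_triangle_ineq)
  then show "CA_norm p (\<lambda>z. a * f z + b) \<le> cmod a * CA_norm p f + cmod b"
    using CA_seminorm_least[OF le] by (simp add: CA_norm_def algebra_simps)
qed

lemma CA0_affine:
  assumes f: "f \<in> CA0 p"
  shows "(\<lambda>z. a * f z + b) \<in> CA0 p"
proof -
  have ca: "f \<in> CA p" using f by (simp add: CA0_def)
  then have h: "f \<in> hardy2" by (simp add: CA_def)
  have "\<exists>\<delta>>0. \<forall>I\<in>arcs. arc_length I < \<delta> \<longrightarrow> \<bar>arc_oscillation p (\<lambda>z. a * f z + b) I\<bar> < \<epsilon>" if \<epsilon>: "0 < \<epsilon>" for \<epsilon>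
  proof -
    \<comment> \<open>Adding \<open>1\<close> avoids a division by zero when
      \<open>a = 0\<close>.\<close>
    have pos: "0 < 1 + (cmod a)\<^sup>2" by (simp add: add_pos_nonneg)
    then obtain \<delta> where \<delta>: "\<delta> > 0" "\<And>I. I \<in> arcs \<Longrightarrow> arc_length I < \<delta> \<Longrightarrow> \<bar>arc_oscillation p f I\<bar> < \<epsilon> / (1 + (cmod a)\<^sup>2)"
      using f divide_pos_pos[OF \<epsilon> pos] unfolding CA0_def by blast
    have "\<bar>arc_oscillation p (\<lambda>z. a * f z + b) I\<bar> < \<epsilon>" if "I \<in> arcs" "arc_length I < \<delta>" for I
    proof -
      have "\<bar>arc_oscillation p (\<lambda>z. a * f z + b) I\<bar> = (cmod a)\<^sup>2 * \<bar>arc_oscillation p f I\<bar>"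
        by (simp add: arc_oscillation_affine[OF h that(1)] abs_mult)
      also have "\<dots> \<le> (1 + (cmod a)\<^sup>2) * \<bar>arc_oscillation p f I\<bar>"
        by (intro mult_right_mono) auto
      also have "\<dots> < \<epsilon>"
        using \<delta>(2)[OF that] pos by (simp add: field_simps)
      finally show ?thesis .
    qed
    then show ?thesis using \<delta>(1) by blast
  qed
  then show ?thesis using CA_affine(1)[OF ca] by (simp add: CA0_def)
qed

lemma affine_maps_boundedly:
  assumes "X = CA p \<or> X = CA0 p" and \<phi>: "\<And>z. \<phi> z = a * z + b"
  shows "maps_boundedly (CA_norm p) X (superposition \<phi>)"
proof -
  have eq: "superposition \<phi> f = (\<lambda>z. a * f z + b)" for f
    by (auto simp: superposition_def \<phi>)
  have X: "X \<subseteq> CA p" using assms(1) by (auto simp: CA0_def)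
  have "superposition \<phi> f \<in> X" if "f \<in> X" for f
    unfolding eq using assms(1) that CA_affine(1) CA0_affine by blast
  moreover have "\<exists>M'. \<forall>f\<in>A. CA_norm p (superposition \<phi> f) \<le> M'"
    if "A \<subseteq> X" "\<forall>f\<in>A. CA_norm p f \<le> M" for A M
  proof (intro exI ballI)
    fix f assume "f \<in> A"
    then have "f \<in> CA p" "CA_norm p f \<le> M" using that X by auto
    then show "CA_norm p (superposition \<phi> f) \<le> cmod a * M + cmod b"
      unfolding eq using CA_affine(2)[of f p a b] mult_left_mono[of "CA_norm p f" M "cmod a"] by simp
  qed
  ultimately show ?thesis unfolding maps_boundedly_def by blast
qed

section \<open>Functions holomorphic up to the boundary\<close>

lemma continuous_on_cis_of_cball:
  fixes g :: "complex \<Rightarrow> complex"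
  assumes "g holomorphic_on cball 0 1"
  shows "continuous_on A (\<lambda>t. g (cis t))"
  by (rule continuous_on_compose2[OF holomorphic_on_imp_continuous_on[OF assms]])
     (auto intro!: continuous_intros)

text \<open>By continuity along the closed radius, the exceptional set is empty for such
  functions.\<close>

lemma radial_limit_cball:
  assumes g: "g holomorphic_on cball 0 1"
  shows "radial_limit g (cis t) = g (cis t)"
proof (rule radial_limitI)
  have "continuous_on {0..1} (\<lambda>r. g (of_real r * cis t))"
    by (rule continuous_on_compose2[OF holomorphic_on_imp_continuous_on[OF g]])
       (auto intro!: continuous_intros simp: norm_mult)
  from this[unfolded continuous_on_def, THEN bspec, of 1] show "((\<lambda>r. g (of_real r * cis t)) \<longlongrightarrow> g (cis t)) (at_left 1)"
    by (simp add: at_within_Icc_at_left)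
qed

lemma bounded_cball:
  fixes g :: "complex \<Rightarrow> complex"
  assumes g: "g holomorphic_on cball 0 1"
  obtains B where "0 \<le> B" "\<And>z. cmod z \<le> 1 \<Longrightarrow> cmod (g z) \<le> B"
proof -
  have "compact (g ` cball 0 1)"
    by (intro compact_continuous_image holomorphic_on_imp_continuous_on g) auto
  then obtain B where "\<And>z. z \<in> cball 0 1 \<Longrightarrow> cmod (g z) \<le> B"
    by (meson compact_imp_bounded bounded_iff image_eqI)
  moreover from this[of 0] have "0 \<le> B" by (simp add: order_trans[OF norm_ge_zero])
  ultimately show thesis using that by simp
qed

lemma hardy2_cball:
  assumes g: "g holomorphic_on cball 0 1"
  shows "g \<in> hardy2"
proof -
  obtain B where B: "0 \<le> B" "\<And>z. cmod z \<le> 1 \<Longrightarrow> cmod (g z) \<le> B"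
    using bounded_cball[OF g] by blast
  have hol: "g holomorphic_on ball 0 1" using g by (rule holomorphic_on_subset) auto
  have "integral {0..2 * pi} (\<lambda>t. (cmod (g (of_real r * cis t)))\<^sup>2) \<le> integral {0..2 * pi} (\<lambda>t. B\<^sup>2)"
    if r: "r \<in> {0..<1}" for r
    by (rule integral_le)
       (use r in \<open>auto intro!: integrable_continuous_real continuous_intros continuous_on_circle_of_radius hol power_mono B
         simp: norm_mult\<close>)
  then show ?thesis unfolding hardy2_iff using hol by blast
qed

lemma arc_mean_cball:
  assumes g: "g holomorphic_on cball 0 1" and I: "(\<alpha>, \<beta>) \<in> arcs"
  shows "arc_mean (\<alpha>, \<beta>) (radial_limit g) = integral {\<alpha>..\<beta>} (\<lambda>t. g (cis t)) / of_real (\<beta> - \<alpha>)"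
proof -
  have "arc_integral (\<alpha>, \<beta>) (radial_limit g) = integral {\<alpha>..\<beta>} (\<lambda>t. g (cis t))"
    unfolding arc_integral_def fst_conv snd_conv radial_limit_cball[OF g]
    by (intro set_lebesgue_integral_eq_integral absolutely_integrable_continuous_real continuous_on_cis_of_cball g)
  moreover have "2 * pi * arc_length (\<alpha>, \<beta>) = \<beta> - \<alpha>" using arc_length_eq[OF I] by simp
  ultimately show ?thesis unfolding arc_mean_def by simp
qed

lemma arc_oscillation_cball:
  assumes g: "g holomorphic_on cball 0 1" and I: "(\<alpha>, \<beta>) \<in> arcs"
  shows "arc_oscillation p g (\<alpha>, \<beta>) = ((\<beta> - \<alpha>) / (2 * pi)) powr (- p) *
    integral {\<alpha>..\<beta>} (\<lambda>t. (cmod (g (cis t) - arc_mean (\<alpha>, \<beta>) (radial_limit g)))\<^sup>2)"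
proof -
  have "arc_integral (\<alpha>, \<beta>) (\<lambda>\<xi>. (cmod (radial_limit g \<xi> - arc_mean (\<alpha>, \<beta>) (radial_limit g)))\<^sup>2) =
     integral {\<alpha>..\<beta>} (\<lambda>t. (cmod (g (cis t) - arc_mean (\<alpha>, \<beta>) (radial_limit g)))\<^sup>2)"
    unfolding arc_integral_def fst_conv snd_conv radial_limit_cball[OF g]
    by (intro set_lebesgue_integral_eq_integral absolutely_integrable_continuous_real continuous_intros
        continuous_on_cis_of_cball g)
  then show ?thesis unfolding arc_oscillation_def arc_length_eq[OF I] by simp
qed

text \<open>Expanding the square shows that subtracting the mean \<open>m\<close> lowers the
  integral by \<open>(b - a) * (cmod m)\<^sup>2\<close>. Oscillations can thus be bounded by plain
  square integrals.\<close>

lemma integral_variance_le: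
  fixes u :: "real \<Rightarrow> complex"
  assumes u: "continuous_on {a..b} u" and ab: "a < b"
  shows "integral {a..b} (\<lambda>t. (cmod (u t - integral {a..b} u / of_real (b - a)))\<^sup>2) \<le> integral {a..b} (\<lambda>t. (cmod (u t))\<^sup>2)"
proof -
  define m where "m = integral {a..b} u / of_real (b - a)"
  have iu: "integral {a..b} u = of_real (b - a) * m" using ab by (simp add: m_def)
  have ii: "u integrable_on {a..b}" by (rule integrable_continuous_real[OF u])
  have Re: "((\<lambda>t. Re (cnj m * u t)) has_integral Re (cnj m * (of_real (b - a) * m))) {a..b}"
    using has_integral_linear[OF has_integral_mult_right[OF integrable_integral[OF ii], of "cnj m"] bounded_linear_Re]
    unfolding iu by (simp add: o_def)
  have "Re (cnj m * (of_real (b - a) * m)) = (b - a) * (cmod m)\<^sup>2"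
    unfolding cmod_power2 by (simp add: power2_eq_square algebra_simps)
  with Re have Re': "((\<lambda>t. Re (cnj m * u t)) has_integral (b - a) * (cmod m)\<^sup>2) {a..b}" by simp
  have eq: "(cmod (u t - m))\<^sup>2 = (cmod (u t))\<^sup>2 - 2 * Re (cnj m * u t) + (cmod m)\<^sup>2" for t
    unfolding cmod_power2 by (simp add: power2_eq_square algebra_simps)
  have iu2: "(\<lambda>t. (cmod (u t))\<^sup>2) integrable_on {a..b}"
    by (intro integrable_continuous_real continuous_intros u)
  have "((\<lambda>t. (cmod (u t - m))\<^sup>2) has_integral
     integral {a..b} (\<lambda>t. (cmod (u t))\<^sup>2) - 2 * ((b - a) * (cmod m)\<^sup>2) + (b - a) * (cmod m)\<^sup>2) {a..b}"
    unfolding eq using ab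
    by (intro has_integral_add has_integral_diff has_integral_mult_right integrable_integral iu2 Re')
       (use has_integral_const_real[of "(cmod m)\<^sup>2" a b] in simp)
  then have "integral {a..b} (\<lambda>t. (cmod (u t - m))\<^sup>2) = integral {a..b} (\<lambda>t. (cmod (u t))\<^sup>2) - (b - a) * (cmod m)\<^sup>2"
    by (simp add: integral_unique)
  then show ?thesis using ab unfolding m_def[symmetric] by simp
qed

lemma arc_oscillation_cball_le:
  assumes g: "g holomorphic_on cball 0 1" and I: "(\<alpha>, \<beta>) \<in> arcs"
  shows "arc_oscillation p g (\<alpha>, \<beta>) \<le> ((\<beta> - \<alpha>) / (2 * pi)) powr (- p) *
    integral {\<alpha>..\<beta>} (\<lambda>t. (cmod (g (cis t)))\<^sup>2)"
  unfolding arc_oscillation_cball[OF g I] arc_mean_cball[OF g I] using I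
  by (intro mult_left_mono integral_variance_le continuous_on_cis_of_cball g) (auto simp: arcs_def)

text \<open>A bounded function has square integral at most a multiple of the arc length, so its
  oscillation is at most of order \<open>arc_length I powr (1 - p)\<close>, which tends to
  \<open>0\<close> because \<open>p < 1\<close>.\<close>

lemma CA0_cball:
  assumes g: "g holomorphic_on cball 0 1" and p: "p < 1"
  shows "g \<in> CA0 p"
proof -
  obtain B where B: "0 \<le> B" "\<And>z. cmod z \<le> 1 \<Longrightarrow> cmod (g z) \<le> B"
    using bounded_cball[OF g] by blast
  have osc: "arc_oscillation p g I \<le> 2 * pi * B\<^sup>2 * arc_length I powr (1 - p)" and len: "0 < arc_length I" "arc_length I \<le> 1"
    if I: "I \<in> arcs" for I
  proof -
    obtain \<alpha> \<beta> where I_eq: "I = (\<alpha>, \<beta>)" and ab: "\<alpha> < \<beta>" "\<beta> \<le> \<alpha> + 2 * pi"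
      using I by (auto simp: arcs_def)
    define l where "l = (\<beta> - \<alpha>) / (2 * pi)"
    have l: "arc_length I = l" "0 < l" "l \<le> 1" "\<beta> - \<alpha> = 2 * pi * l"
      using arc_length_eq I ab unfolding I_eq l_def by (auto simp: field_simps)
    then show "0 < arc_length I" "arc_length I \<le> 1" by auto
    have "integral {\<alpha>..\<beta>} (\<lambda>t. (cmod (g (cis t)))\<^sup>2) \<le> integral {\<alpha>..\<beta>} (\<lambda>t. B\<^sup>2)"
      by (rule integral_le)
         (auto intro!: integrable_continuous_real continuous_intros continuous_on_cis_of_cball g power_mono B)
    also have "\<dots> = 2 * pi * l * B\<^sup>2" using ab l by simp
    finally have int: "integral {\<alpha>..\<beta>} (\<lambda>t. (cmod (g (cis t)))\<^sup>2) \<le> 2 * pi * l * B\<^sup>2" .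
    have "arc_oscillation p g I \<le> l powr (- p) * integral {\<alpha>..\<beta>} (\<lambda>t. (cmod (g (cis t)))\<^sup>2)"
      using arc_oscillation_cball_le[OF g] I unfolding I_eq l_def by blast
    also have "\<dots> \<le> l powr (- p) * (2 * pi * l * B\<^sup>2)"
      by (rule mult_left_mono[OF int]) simp
    also have "\<dots> = 2 * pi * B\<^sup>2 * (l powr (- p) * l powr 1)" using l by simp
    also have "l powr (- p) * l powr 1 = l powr (1 - p)" unfolding powr_add[symmetric] by simp
    finally show "arc_oscillation p g I \<le> 2 * pi * B\<^sup>2 * arc_length I powr (1 - p)" using l by simp
  qed
  have "arc_oscillation p g I \<le> 2 * pi * B\<^sup>2" if "I \<in> arcs" for I
  proof -
    have "arc_length I powr (1 - p) \<le> 1" using len[OF that] p by (simp add: powr_le1)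
    then have "2 * pi * B\<^sup>2 * arc_length I powr (1 - p) \<le> 2 * pi * B\<^sup>2"
      by (intro mult_left_le) auto
    then show ?thesis using osc[OF that] by linarith
  qed
  then have "bdd_above ((\<lambda>I. sqrt (arc_oscillation p g I)) ` arcs)"
    by (intro bdd_aboveI2[where M = "sqrt (2 * pi * B\<^sup>2)"]) simp
  then have "g \<in> CA p" using hardy2_cball[OF g] by (simp add: CA_def)
  moreover have "\<exists>\<delta>>0. \<forall>I\<in>arcs. arc_length I < \<delta> \<longrightarrow> \<bar>arc_oscillation p g I\<bar> < \<epsilon>" if \<epsilon>: "0 < \<epsilon>" for \<epsilon>
  proof -
    \<comment> \<open>\<open>D\<close> is positive even if \<open>B = 0\<close>; the length bound
      that follows solves \<open>D * \<delta> powr (1 - p) = \<epsilon>\<close>.\<close>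
    define D where "D = 2 * pi * B\<^sup>2 + 1"
    have D: "0 < D" "2 * pi * B\<^sup>2 \<le> D" by (auto simp: D_def add_nonneg_pos)
    have "\<bar>arc_oscillation p g I\<bar> < \<epsilon>" if I: "I \<in> arcs" "arc_length I < (\<epsilon> / D) powr (1 / (1 - p))" for I
    proof -
      have "arc_length I powr (1 - p) < ((\<epsilon> / D) powr (1 / (1 - p))) powr (1 - p)"
        using len[OF I(1)] I p by (intro powr_less_mono2) auto
      also have "\<dots> = \<epsilon> / D" using p \<epsilon> D by (simp add: powr_powr)
      finally have "D * arc_length I powr (1 - p) < \<epsilon>" using D by (simp add: field_simps)
      moreover have "2 * pi * B\<^sup>2 * arc_length I powr (1 - p) \<le> D * arc_length I powr (1 - p)"
        using D by (intro mult_right_mono) auto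
      ultimately show ?thesis using osc[OF I(1)] arc_oscillation_nonneg[of p g I] by linarith
    qed
    then show ?thesis using \<epsilon> D by (intro exI[of _ "(\<epsilon> / D) powr (1 / (1 - p))"]) auto
  qed
  ultimately show ?thesis by (simp add: CA0_def)
qed

text \<open>A multiple of the Szego kernel of the point \<open>1 - h\<close>. Its value at
  \<open>1\<close> is \<open>h powr ((p - 1) / 2)\<close>, and its modulus is comparable to this on
  an arc of length about \<open>h\<close>; the exponent is the one that keeps the norms bounded in
  \<open>h\<close>.\<close>

definition test_function :: "real \<Rightarrow> real \<Rightarrow> complex \<Rightarrow> complex" where
  "test_function p h z = of_real (h powr ((1 + p) / 2)) / (1 - of_real (1 - h) * z)"

lemma test_denominator_nonzero:
  assumes "0 < h" "h < 1" "cmod z \<le> 1"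
  shows "1 - of_real (1 - h) * z \<noteq> 0"
proof
  assume "1 - of_real (1 - h) * z = 0"
  then have "cmod (of_real (1 - h) * z) = 1" by simp
  moreover have "cmod (of_real (1 - h) * z) = (1 - h) * cmod z"
    unfolding norm_mult norm_of_real using assms by simp
  ultimately show False using assms mult_left_le[of "cmod z" "1 - h"] by simp
qed

lemma holomorphic_test_function:
  assumes "0 < h" "h < 1"
  shows "test_function p h holomorphic_on cball 0 1"
  unfolding test_function_def using test_denominator_nonzero[OF assms] by (intro holomorphic_intros) auto

text \<open>Two estimates of the square integral over an arc of normalised length \<open>l\<close>:
  the full Poisson mass gives order \<open>h powr p\<close>, the maximum of the modulus gives
  \<open>l * h powr (p - 1)\<close>. The first serves for \<open>h \<le> l\<close>, the second for
  shorter arcs; divided by \<open>l powr p\<close>, each is at most \<open>2 * pi\<close>.\<close>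

lemma CA_norm_test_function_le:
  assumes h: "0 < h" "h < 1" and w: "cmod w = 1" and p: "0 \<le> p" "p < 1"
  shows "CA_norm p (\<lambda>z. w * test_function p h z) \<le> 1 + sqrt (2 * pi)"
proof -
  define f where "f z = w * test_function p h z" for z
  have f: "f holomorphic_on cball 0 1"
    unfolding f_def by (intro holomorphic_intros holomorphic_test_function h)
  define \<rho> where "\<rho> = 1 - h"
  have \<rho>: "\<bar>\<rho>\<bar> < 1" "0 < \<rho>" using h by (auto simp: \<rho>_def)
  have \<rho>h: "h \<le> 1 - \<rho>\<^sup>2"
    using h mult_left_le[of h h] by (simp add: \<rho>_def power2_eq_square algebra_simps)
  have A: "(h powr ((1 + p) / 2))\<^sup>2 = h powr (1 + p)"
    using h by (simp add: powr_power add_divide_distrib)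
  have f2: "(cmod (f (cis t)))\<^sup>2 = h powr (1 + p) / (1 - \<rho>\<^sup>2) * poisson \<rho> t" for t
    using \<rho>h h unfolding f_def test_function_def poisson_def \<rho>_def[symmetric]
    by (simp add: norm_mult norm_divide w power_divide A)
  have dist: "h \<le> cmod (1 - of_real \<rho> * cis t)" for t
  proof -
    have "cmod 1 - cmod (of_real \<rho> * cis t) \<le> cmod (1 - of_real \<rho> * cis t)" by (rule norm_triangle_ineq2)
    moreover have "cmod (of_real \<rho> * cis t) = 1 - h"
      using \<rho> by (simp only: norm_mult norm_of_real) (simp add: \<rho>_def)
    ultimately show ?thesis by simp
  qed
  have "arc_oscillation p f I \<le> 2 * pi" if I: "I \<in> arcs" for I
  proof -
    obtain \<alpha> \<beta> where I_eq: "I = (\<alpha>, \<beta>)" and ab: "\<alpha> < \<beta>" "\<beta> \<le> \<alpha> + 2 * pi"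
      using I by (auto simp: arcs_def)
    define l where "l = (\<beta> - \<alpha>) / (2 * pi)"
    have l: "0 < l" "l \<le> 1" "\<beta> - \<alpha> = 2 * pi * l"
      using ab unfolding l_def by (auto simp: field_simps)
    define Q where "Q = integral {\<alpha>..\<beta>} (\<lambda>t. (cmod (f (cis t)))\<^sup>2)"
    have fi: "(\<lambda>t. (cmod (f (cis t)))\<^sup>2) integrable_on {u..v}" for u v
      by (intro integrable_continuous_real continuous_intros continuous_on_cis_of_cball f)
    have "Q \<le> integral {\<alpha>..\<alpha> + 2 * pi} (\<lambda>t. (cmod (f (cis t)))\<^sup>2)"
      unfolding Q_def by (rule integral_subset_le) (use ab fi in auto)
    also have "\<dots> = integral {- pi..- pi + 2 * pi} (\<lambda>t. (cmod (f (cis t)))\<^sup>2)"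
      by (rule integral_circle_shift)
         (auto intro!: continuous_intros continuous_on_subset[OF holomorphic_on_imp_continuous_on[OF f]])
    also have "\<dots> = h powr (1 + p) / (1 - \<rho>\<^sup>2) * (2 * pi)"
      unfolding f2 using poisson_integral_one[OF \<rho>(1)] by (simp add: integral_unique)
    also have "\<dots> \<le> h powr (1 + p) / h * (2 * pi)"
      using \<rho>h h by (intro mult_right_mono divide_left_mono) auto
    also have "h powr (1 + p) / h = h powr p"
      using h by (simp add: powr_add)
    finally have Q1: "Q \<le> h powr p * (2 * pi)" .
    have "Q \<le> integral {\<alpha>..\<beta>} (\<lambda>t. h powr (1 + p) / h\<^sup>2)"
      unfolding Q_def
    proof (rule integral_le[OF fi])
      fix t
      have "(cmod (f (cis t)))\<^sup>2 = h powr (1 + p) / (cmod (1 - of_real \<rho> * cis t))\<^sup>2"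
        unfolding f_def test_function_def \<rho>_def[symmetric]
        by (simp add: norm_mult norm_divide w power_divide A)
      also have "\<dots> \<le> h powr (1 + p) / h\<^sup>2"
        using dist[of t] h by (intro divide_left_mono power_mono) (auto intro!: mult_pos_pos zero_less_power simp: less_le_trans[OF h(1) dist])
      finally show "(cmod (f (cis t)))\<^sup>2 \<le> h powr (1 + p) / h\<^sup>2" .
    qed auto
    also have "\<dots> = h powr (p - 1) * l * (2 * pi)"
    proof -
      have "h powr (1 + p) / h\<^sup>2 = h powr (1 + p) / h powr 2" using h by (simp add: powr_numeral)
      also have "\<dots> = h powr (p - 1)" by (simp flip: powr_diff)
      finally show ?thesis using ab l by simp
    qed
    finally have Q2: "Q \<le> h powr (p - 1) * l * (2 * pi)" .
    have "l powr (- p) * Q \<le> 2 * pi"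
    proof (cases "h \<le> l")
      case True
      have "l powr (- p) * Q \<le> l powr (- p) * (h powr p * (2 * pi))"
        by (rule mult_left_mono[OF Q1]) simp
      also have "\<dots> \<le> l powr (- p) * (l powr p * (2 * pi))"
        using True h p by (intro mult_left_mono mult_right_mono powr_mono2) auto
      also have "\<dots> = 2 * pi" using l by (simp add: powr_minus)
      finally show ?thesis .
    next
      case False
      have "l powr (- p) * Q \<le> l powr (- p) * (h powr (p - 1) * l * (2 * pi))"
        by (rule mult_left_mono[OF Q2]) simp
      also have "\<dots> = (l powr (- p) * l powr 1) * h powr (p - 1) * (2 * pi)" using l by simp
      also have "l powr (- p) * l powr 1 = l powr (1 - p)" unfolding powr_add[symmetric] by simp
      also have "l powr (1 - p) * h powr (p - 1) * (2 * pi) \<le> h powr (1 - p) * h powr (p - 1) * (2 * pi)"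
        using False l p by (intro mult_right_mono powr_mono2) auto
      also have "\<dots> = 2 * pi" using h by (simp flip: powr_add)
      finally show ?thesis .
    qed
    moreover have "arc_oscillation p f I \<le> l powr (- p) * Q"
      using arc_oscillation_cball_le[OF f] I unfolding I_eq l_def Q_def by blast
    ultimately show ?thesis by simp
  qed
  then have "CA_seminorm p f \<le> sqrt (2 * pi)"
    by (intro CA_seminorm_least) simp
  moreover have "cmod (f 0) \<le> 1"
    using h p by (simp add: f_def test_function_def norm_mult w powr_le1)
  ultimately show ?thesis unfolding f_def CA_norm_def by linarith
qed

section \<open>Odd averages of superpositions\<close>

text \<open>Odd averages annihilate constants, so near \<open>1\<close> they are controlled by the mean oscillation.
  The weight \<open>k\<close> is the one balancing the two terms of \<open>2 \<bar>u\<bar> \<le> k + \<bar>u\<bar>\<^sup>2 / k\<close>.\<close>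

lemma odd_average_le:
  assumes g: "g holomorphic_on cball 0 1" and ca: "g \<in> CA p" and M: "CA_norm p g \<le> M" "0 < M"
    and \<tau>: "0 < \<tau>" "\<tau> \<le> 1" and p: "0 \<le> p" "p < 1"
  shows "cmod (integral {0..\<tau>} (\<lambda>t. g (cis t) - g (cis (- t)))) \<le> 2 * M * \<tau> powr ((1 + p) / 2)"
proof -
  have pi: "1 < pi" using pi_gt3 by linarith
  have I: "(- \<tau>, \<tau>) \<in> arcs" using \<tau> pi by (simp add: arcs_def)
  define m where "m = arc_mean (- \<tau>, \<tau>) (radial_limit g)"
  define u where "u t = cmod (g (cis t) - m)" for t
  have uc: "continuous_on A u" for A
    unfolding u_def by (intro continuous_intros continuous_on_cis_of_cball g)
  have uc': "continuous_on A (\<lambda>t. u (- t))" for A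
    by (rule continuous_on_compose2[OF uc[of UNIV]]) (auto intro!: continuous_intros)
  have gc': "continuous_on A (\<lambda>t. g (cis (- t)))" for A
    by (rule continuous_on_compose2[OF continuous_on_cis_of_cball[OF g, of UNIV]]) (auto intro!: continuous_intros)
  define V where "V = integral {- \<tau>..\<tau>} (\<lambda>t. (u t)\<^sup>2)"
  have "sqrt (arc_oscillation p g (- \<tau>, \<tau>)) \<le> M"
    using CA_seminorm_upper[OF ca I] M norm_ge_zero[of "g 0"] unfolding CA_norm_def by linarith
  then have "arc_oscillation p g (- \<tau>, \<tau>) \<le> M\<^sup>2"
    by (rule sqrt_le_D)
  moreover have "arc_oscillation p g (- \<tau>, \<tau>) = (\<tau> / pi) powr (- p) * V"
    unfolding arc_oscillation_cball[OF g I] V_def u_def m_def by simp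
  ultimately have "(\<tau> / pi) powr p * ((\<tau> / pi) powr (- p) * V) \<le> (\<tau> / pi) powr p * M\<^sup>2"
    by (intro mult_left_mono) auto
  moreover have "(\<tau> / pi) powr p * ((\<tau> / pi) powr (- p) * V) = V"
    using \<tau> by (simp add: powr_minus flip: mult.assoc)
  ultimately have "V \<le> (\<tau> / pi) powr p * M\<^sup>2" by simp
  also have "\<dots> \<le> \<tau> powr p * M\<^sup>2"
    using \<tau> pi p by (intro mult_right_mono powr_mono2) (auto simp: field_simps)
  finally have V: "V \<le> \<tau> powr p * M\<^sup>2" .
  define k where "k = M * \<tau> powr ((p - 1) / 2)"
  have k: "0 < k" using M \<tau> by (simp add: k_def)
  have "cmod (integral {0..\<tau>} (\<lambda>t. g (cis t) - g (cis (- t)))) \<le> integral {0..\<tau>} (\<lambda>t. u t + u (- t))"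
  proof (rule integral_norm_bound_integral)
    fix t
    have "g (cis t) - g (cis (- t)) = (g (cis t) - m) - (g (cis (- t)) - m)" by simp
    then show "cmod (g (cis t) - g (cis (- t))) \<le> u t + u (- t)"
      unfolding u_def by (metis norm_triangle_ineq4)
  qed (auto intro!: integrable_continuous_real continuous_intros continuous_on_cis_of_cball g gc' uc uc')
  also have "\<dots> = integral {- \<tau>..\<tau>} u"
    by (rule integral_symmetric_interval[symmetric]) (use uc \<tau> in auto)
  also have "\<dots> \<le> integral {- \<tau>..\<tau>} (\<lambda>t. k / 2 + (u t)\<^sup>2 / (2 * k))"
  proof (rule integral_le)
    fix t
    have "2 * k * u t \<le> k\<^sup>2 + (u t)\<^sup>2"
      using zero_le_power2[of "k - u t"] by (simp add: power2_diff)
    then show "u t \<le> k / 2 + (u t)\<^sup>2 / (2 * k)"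
      using k by (simp add: field_simps power2_eq_square)
  qed (auto intro!: integrable_continuous_real continuous_intros uc simp: k[THEN less_imp_neq, symmetric])
  also have "\<dots> = k * \<tau> + V / (2 * k)"
    unfolding V_def using \<tau>
    by (subst integral_add) (auto intro!: integrable_continuous_real continuous_intros uc simp: k[THEN less_imp_neq, symmetric])
  also have "\<dots> \<le> k * \<tau> + \<tau> powr p * M\<^sup>2 / (2 * k)"
    using V k by (intro add_left_mono divide_right_mono) auto
  also have "k * \<tau> = M * \<tau> powr ((1 + p) / 2)"
  proof -
    have "\<tau> powr ((p - 1) / 2) * \<tau> powr 1 = \<tau> powr ((1 + p) / 2)"
      unfolding powr_add[symmetric] by (simp add: field_simps)
    then show ?thesis using \<tau> by (simp add: k_def mult.assoc)
  qed
  also have "\<tau> powr p * M\<^sup>2 / (2 * k) = M * \<tau> powr ((1 + p) / 2) / 2"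
  proof -
    have "\<tau> powr p / \<tau> powr ((p - 1) / 2) = \<tau> powr ((1 + p) / 2)"
      unfolding powr_diff[symmetric] by (simp add: field_simps)
    then show ?thesis using M \<tau> by (simp add: k_def power2_eq_square field_simps)
  qed
  also have "M * \<tau> powr ((1 + p) / 2) + M * \<tau> powr ((1 + p) / 2) / 2 \<le> 2 * M * \<tau> powr ((1 + p) / 2)"
    using M by simp
  finally show ?thesis .
qed

text \<open>Differentiating under the integral raises the index \<open>k\<close> by one; stating
  this for all \<open>k\<close> at once lets the induction run. At \<open>w = 0\<close> the
  derivative factor becomes the constant \<open>(deriv ^^ k) \<phi> 0\<close>.\<close>

lemma higher_deriv_integral_dilation:
  fixes u :: "real \<Rightarrow> complex"
  assumes \<phi>: "\<phi> holomorphic_on UNIV" and u: "continuous_on {a..b} u"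
  defines "J \<equiv> \<lambda>k w. integral {a..b} (\<lambda>t. u t ^ k * (deriv ^^ k) \<phi> (w * u t))"
  shows "J k holomorphic_on UNIV" and "(deriv ^^ k) (J 0) = J k"
proof -
  have hd: "(deriv ^^ k) \<phi> holomorphic_on UNIV" for k
    by (rule holomorphic_higher_deriv[OF \<phi> open_UNIV])
  have cont: "continuous_on A (\<lambda>x. (deriv ^^ k) \<phi> (h x))" if "continuous_on A h" for k A and h :: "'b::topological_space \<Rightarrow> complex"
    by (rule continuous_on_compose2[OF holomorphic_on_imp_continuous_on[OF hd[of k]] that]) auto
  have D: "(J k has_field_derivative J (Suc k) w) (at w)" for k w
  proof -
    have "((\<lambda>w. integral (cbox a b) (\<lambda>t. u t ^ k * (deriv ^^ k) \<phi> (w * u t))) has_field_derivative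
        integral (cbox a b) (\<lambda>t. u t ^ Suc k * (deriv ^^ Suc k) \<phi> (w * u t))) (at w within UNIV)"
    proof (rule leibniz_rule_field_derivative)
      fix x t
      have "((deriv ^^ k) \<phi> has_field_derivative (deriv ^^ Suc k) \<phi> (x * u t)) (at (x * u t))"
        using holomorphic_derivI[OF hd open_UNIV] by simp
      then have "((\<lambda>x. (deriv ^^ k) \<phi> (x * u t)) has_field_derivative (deriv ^^ Suc k) \<phi> (x * u t) * u t) (at x)"
        by (rule DERIV_chain2) (auto intro!: derivative_eq_intros)
      from DERIV_cmult[OF this, of "u t ^ k"]
      show "((\<lambda>x. u t ^ k * (deriv ^^ k) \<phi> (x * u t)) has_field_derivative u t ^ Suc k * (deriv ^^ Suc k) \<phi> (x * u t)) (at x within UNIV)"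
        by (simp add: mult_ac)
    next
      show "(\<lambda>t. u t ^ k * (deriv ^^ k) \<phi> (x * u t)) integrable_on cbox a b" for x
        unfolding box_real by (intro integrable_continuous_real continuous_intros cont u)
      show "continuous_on (UNIV \<times> cbox a b) (\<lambda>(x, t). u t ^ Suc k * (deriv ^^ Suc k) \<phi> (x * u t))"
        unfolding split_beta box_real
        by (intro continuous_intros cont continuous_on_compose2[OF u]) auto
    qed auto
    then show ?thesis unfolding J_def by simp
  qed
  show "J k holomorphic_on UNIV"
    using D by (auto simp: holomorphic_on_open)
  show "(deriv ^^ k) (J 0) = J k"
    by (induction k) (use D in \<open>auto intro: DERIV_imp_deriv\<close>)
qed

text \<open>As a function of \<open>w\<close>, the integral is entire, and its \<open>n\<close>-th
  derivative at \<open>0\<close> is \<open>(deriv ^^ n) \<phi> 0\<close> times the integral of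
  \<open>u t ^ n - v t ^ n\<close>. Cauchy's inequality on the unit circle therefore isolates a
  single coefficient.\<close>

lemma odd_average_coefficient_bound:
  fixes u v :: "real \<Rightarrow> complex"
  assumes \<phi>: "\<phi> holomorphic_on UNIV" and u: "continuous_on {a..b} u" and v: "continuous_on {a..b} v"
    and B: "\<And>w. cmod w = 1 \<Longrightarrow> cmod (integral {a..b} (\<lambda>t. \<phi> (w * u t) - \<phi> (w * v t))) \<le> B"
  shows "cmod ((deriv ^^ n) \<phi> 0) * cmod (integral {a..b} (\<lambda>t. u t ^ n - v t ^ n)) \<le> fact n * B"
proof -
  define J where "J u k w = integral {a..b} (\<lambda>t. u t ^ k * (deriv ^^ k) \<phi> (w * u t))" for u k w
  have hol: "J u k holomorphic_on UNIV" "J v k holomorphic_on UNIV" for k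
    unfolding J_def by (rule higher_deriv_integral_dilation[OF \<phi>], fact)+
  have der: "(deriv ^^ k) (J u 0) = J u k" "(deriv ^^ k) (J v 0) = J v k" for k
    unfolding J_def by (rule higher_deriv_integral_dilation[OF \<phi>], fact)+
  define F where "F w = J u 0 w - J v 0 w" for w
  have F: "F holomorphic_on UNIV" unfolding F_def by (intro holomorphic_intros hol)
  have cont: "(\<lambda>t. \<phi> (w * h t)) integrable_on {a..b}" if "continuous_on {a..b} h" for w h
    by (intro integrable_continuous_real continuous_on_compose2[OF holomorphic_on_imp_continuous_on[OF \<phi>]] continuous_intros that) auto
  have "cmod ((deriv ^^ n) F 0) \<le> fact n * B / 1 ^ n"
  proof (rule Cauchy_inequality)
    show "cmod (F w) \<le> B" if "cmod (0 - w) = 1" for w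
    proof -
      have "F w = integral {a..b} (\<lambda>t. \<phi> (w * u t) - \<phi> (w * v t))"
        unfolding F_def J_def by (subst integral_diff) (use cont u v in auto)
      then show ?thesis using B[of w] that by simp
    qed
  qed (use F in \<open>auto intro: holomorphic_on_subset holomorphic_on_imp_continuous_on continuous_on_subset\<close>)
  moreover have "(deriv ^^ n) F 0 = (deriv ^^ n) \<phi> 0 * integral {a..b} (\<lambda>t. u t ^ n - v t ^ n)"
  proof -
    have "(deriv ^^ n) F 0 = J u n 0 - J v n 0"
      unfolding F_def by (subst higher_deriv_diff[OF hol(1) hol(2)]) (auto simp: der)
    also have "\<dots> = integral {a..b} (\<lambda>t. u t ^ n) * (deriv ^^ n) \<phi> 0 - integral {a..b} (\<lambda>t. v t ^ n) * (deriv ^^ n) \<phi> 0"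
      unfolding J_def by simp
    also have "\<dots> = (deriv ^^ n) \<phi> 0 * (integral {a..b} (\<lambda>t. u t ^ n) - integral {a..b} (\<lambda>t. v t ^ n))"
      by (simp add: algebra_simps)
    also have "integral {a..b} (\<lambda>t. u t ^ n) - integral {a..b} (\<lambda>t. v t ^ n) = integral {a..b} (\<lambda>t. u t ^ n - v t ^ n)"
      by (intro integral_diff[symmetric] integrable_continuous_real continuous_intros u v)
    finally show ?thesis .
  qed
  ultimately show ?thesis by (simp add: norm_mult)
qed

text \<open>The function \<open>inverse z ^ n + of_nat n * z\<close> has derivative \<open>0\<close>
  at \<open>1\<close>, so near \<open>1\<close> it is Lipschitz with constant
  \<open>real n / 2\<close>. Half of the linear term \<open>of_nat n * (a - b)\<close> is then left
  over for a lower bound.\<close>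

lemma inverse_power_odd_difference:
  fixes n :: nat
  obtains \<delta> where "0 < \<delta>" "\<delta> \<le> 1"
    "\<And>a b. cmod (a - 1) \<le> \<delta> \<Longrightarrow> cmod (b - 1) \<le> \<delta> \<Longrightarrow>
       cmod (inverse a ^ n - inverse b ^ n + of_nat n * (a - b)) \<le> real n / 2 * cmod (a - b)"
\<comment> \<open>For \<open>n = 0\<close> the tolerance \<open>real n / 2\<close> vanishes, and
  continuity of \<open>D\<close> at \<open>1\<close> would yield nothing.\<close>
proof (cases "n = 0")
  case True
  then show ?thesis using that[of 1] by simp
next
  case False
  define G where "G z = inverse z ^ n + of_nat n * z" for z :: complex
  define D where "D z = of_nat n - of_nat n * inverse z ^ (n - 1) * (inverse z)\<^sup>2" for z :: complex
  have "isCont D 1" unfolding D_def by (intro continuous_intros) auto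
  moreover have "D 1 = 0" by (simp add: D_def)
  ultimately obtain d where d: "0 < d" "\<And>z. dist z 1 < d \<Longrightarrow> cmod (D z) < real n / 2"
    using False unfolding continuous_at_eps_delta
    by (metis dist_0_norm dist_commute half_gt_zero of_nat_0_less_iff neq0_conv)
  \<comment> \<open>At most \<open>1 / 2\<close> to keep \<open>0\<close> out of the disk;
    \<open>d / 2\<close> because the bound on \<open>D\<close> holds for distances strictly below
    \<open>d\<close>.\<close>
  define \<delta> where "\<delta> = min (1 / 2) (d / 2)"
  show ?thesis
  proof (rule that[of \<delta>])
    fix a b assume ab: "cmod (a - 1) \<le> \<delta>" "cmod (b - 1) \<le> \<delta>"
    have "cmod (G a - G b) \<le> real n / 2 * cmod (a - b)"
    proof (rule field_differentiable_bound[where S = "cball 1 \<delta>" and f' = D])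
      fix z :: complex assume "z \<in> cball 1 \<delta>"
      then have z: "dist z 1 \<le> \<delta>" by (simp add: dist_commute)
      have "z \<noteq> 0" using z by (auto simp: \<delta>_def)
      then show "(G has_field_derivative D z) (at z within cball 1 \<delta>)"
        unfolding G_def D_def by (auto intro!: derivative_eq_intros simp: power2_eq_square)
      show "cmod (D z) \<le> real n / 2"
        using d(2)[of z] z d(1) by (simp add: \<delta>_def min_def split: if_splits)
    qed (use ab in \<open>auto simp: dist_norm norm_minus_commute\<close>)
    then show "cmod (inverse a ^ n - inverse b ^ n + of_nat n * (a - b)) \<le> real n / 2 * cmod (a - b)"
      by (simp add: G_def algebra_simps)
  qed (use d in \<open>auto simp: \<delta>_def\<close>)
qed

lemma sin_ge_half:
  assumes "0 \<le> t" "t \<le> 1"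
  shows "t / 2 \<le> sin (t::real)"
proof -
  have "\<bar>sin t - t\<bar> \<le> inverse (fact 3) * \<bar>t\<bar> ^ 3"
    using Maclaurin_sin_bound[of t 3] by (simp add: eval_nat_numeral sin_coeff_def)
  moreover have "t ^ 3 \<le> t" using assms power_decreasing[of 1 3 t] by simp
  moreover have "t - sin t \<le> \<bar>sin t - t\<bar>" by simp
  ultimately have "t - sin t \<le> t / 6" using assms by (simp add: fact_numeral)
  then show ?thesis using assms by simp
qed

lemma cmod_one_minus_cis_le: "cmod (1 - cis t) \<le> \<bar>t\<bar>"
proof -
  have "cmod (1 - cis t) = 2 * \<bar>sin (t / 2)\<bar>"
    using dist_exp_i_1[of t] by (simp add: cis_conv_exp norm_minus_commute)
  then show ?thesis using abs_sin_x_le_abs_x[of "t / 2"] by simp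
qed

text \<open>On the scale \<open>h\<close>, \<open>test_function p h (cis t)\<close> is close to a multiple of \<open>1 / (1 - i t / h)\<close>, whose
  powers have an odd part of the same size as themselves.\<close>

lemma test_function_power_odd_average:
  fixes n :: nat
  assumes n: "1 \<le> n"
  obtains \<delta> where "0 < \<delta>" "\<delta> \<le> 1"
    "\<And>h. 0 < h \<Longrightarrow> h \<le> 1 / 2 \<Longrightarrow> (h powr ((1 + p) / 2) / h) ^ n * (\<delta>\<^sup>2 * h / 8) \<le>
       cmod (integral {0..\<delta> * h} (\<lambda>t. test_function p h (cis t) ^ n - test_function p h (cis (- t)) ^ n))"
proof -
  obtain \<delta> where \<delta>: "0 < \<delta>" "\<delta> \<le> 1" and diff:
    "\<And>a b. cmod (a - 1) \<le> \<delta> \<Longrightarrow> cmod (b - 1) \<le> \<delta> \<Longrightarrow>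
       cmod (inverse a ^ n - inverse b ^ n + of_nat n * (a - b)) \<le> real n / 2 * cmod (a - b)"
    using inverse_power_odd_difference[of n] by blast
  show thesis
  proof (rule that[OF \<delta>])
    fix h :: real assume h: "0 < h" "h \<le> 1 / 2"
    define E where "E = h powr ((1 + p) / 2) / h"
    have E: "0 < E" using h by (simp add: E_def)
    \<comment> \<open>Chosen so that the denominator of the test function on the circle is
      \<open>h * v t\<close>. The condition \<open>h \<le> 1 / 2\<close> makes \<open>q\<close> at
      least \<open>1 / (2 * h)\<close>, and \<open>q * h \<le> 1\<close> keeps \<open>v\<close>
      within \<open>\<delta>\<close> of \<open>1\<close> for angles up to
      \<open>\<delta> * h\<close>.\<close>
    define q where "q = (1 - h) / h"
    have q: "1 / (2 * h) \<le> q" "0 < q" "q * h \<le> 1" using h by (auto simp: q_def field_simps)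
    define v where "v t = 1 + of_real q * (1 - cis t)" for t
    have f: "test_function p h (cis t) = of_real E * inverse (v t)" for t
    proof -
      have "1 - of_real (1 - h) * cis t = of_real h * v t"
        using h by (simp add: v_def q_def field_simps)
      then show ?thesis unfolding test_function_def E_def using h by (simp add: field_simps)
    qed
    have tf: "test_function p h (cis t) ^ n - test_function p h (cis (- t)) ^ n =
        of_real (E ^ n) * (inverse (v t) ^ n - inverse (v (- t)) ^ n)" for t
      unfolding f by (simp add: power_mult_distrib right_diff_distrib)
    have lower: "t / (4 * h) \<le> Im (inverse (v t) ^ n - inverse (v (- t)) ^ n)" if t: "t \<in> {0..\<delta> * h}" for t
    proof -
      have t1: "0 \<le> t" "t \<le> \<delta> * h" "t \<le> 1"
        using t \<delta> h mult_le_one[of \<delta> h] by auto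
      have near: "cmod (v s - 1) \<le> \<delta>" if "\<bar>s\<bar> = t" for s
      proof -
        have "cmod (v s - 1) \<le> q * \<bar>s\<bar>"
          using cmod_one_minus_cis_le[of s] q by (simp add: v_def norm_mult mult_left_mono)
        also have "\<dots> \<le> q * (\<delta> * h)" using q t1 that by (intro mult_left_mono) auto
        also have "\<dots> \<le> \<delta>" using q(3) \<delta> mult_left_le[of "q * h" \<delta>] by (simp add: mult_ac)
        finally show ?thesis .
      qed
      \<comment> \<open>The difference is purely imaginary, so the lower bound is sought in the
        imaginary part.\<close>
      have vv: "v t - v (- t) = of_real (- 2 * q * sin t) * \<i>"
        by (simp add: v_def complex_eq_iff)
      have sin: "0 \<le> sin t" "t / 2 \<le> sin t" using sin_ge_half[of t] t1 by auto
      define d where "d = inverse (v t) ^ n - inverse (v (- t)) ^ n"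
      have "cmod (d + of_nat n * (v t - v (- t))) \<le> real n / 2 * cmod (v t - v (- t))"
        unfolding d_def by (rule diff) (use near t1 in auto)
      moreover have "cmod (v t - v (- t)) = 2 * q * sin t"
        unfolding vv norm_mult norm_of_real using q sin by (simp add: abs_mult)
      moreover have "\<bar>Im (d + of_nat n * (v t - v (- t)))\<bar> \<le> cmod (d + of_nat n * (v t - v (- t)))"
        by (rule abs_Im_le_cmod)
      moreover have "Im (d + of_nat n * (v t - v (- t))) = Im d - real n * (2 * q * sin t)"
        unfolding vv by simp
      \<comment> \<open>The imaginary part differs from \<open>real n * (2 * q * sin t)\<close> by
        at most half of it, so at least half remains.\<close>
      ultimately have "real n * (q * sin t) \<le> Im d" by (simp add: abs_le_iff)
      moreover have "1 * (1 / (2 * h) * (t / 2)) \<le> real n * (q * sin t)"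
        using n q sin h t1 by (intro mult_mono) auto
      ultimately show ?thesis unfolding d_def by simp
    qed
    define S where "S t = test_function p h (cis t) ^ n - test_function p h (cis (- t)) ^ n" for t
    have hol: "test_function p h holomorphic_on cball 0 1" by (rule holomorphic_test_function) (use h in auto)
    have Sc: "continuous_on A S" for A
      unfolding S_def
      by (intro continuous_intros continuous_on_cis_of_cball hol
          continuous_on_compose2[OF continuous_on_cis_of_cball[OF hol, of UNIV]]) auto
    \<comment> \<open>Integrating the pointwise bound \<open>t / (4 * h)\<close> over
      \<open>{0..\<delta> * h}\<close> produces the factor
      \<open>\<delta>\<^sup>2 * h / 8\<close>.\<close>
    have "((\<lambda>t. E ^ n * (t / (4 * h))) has_integral
        (E ^ n * ((\<delta> * h)\<^sup>2 / (8 * h)) - E ^ n * (0\<^sup>2 / (8 * h)))) {0..\<delta> * h}"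
    proof (rule fundamental_theorem_of_calculus)
      show "((\<lambda>t. E ^ n * (t\<^sup>2 / (8 * h))) has_vector_derivative E ^ n * (t / (4 * h))) (at t within {0..\<delta> * h})" for t
        unfolding has_real_derivative_iff_has_vector_derivative[symmetric]
        using h by (auto intro!: derivative_eq_intros)
    qed (use \<delta> h in auto)
    then have "((\<lambda>t. E ^ n * (t / (4 * h))) has_integral E ^ n * (\<delta>\<^sup>2 * h / 8)) {0..\<delta> * h}"
      using h by (simp add: power2_eq_square field_simps)
    moreover have "((\<lambda>t. Im (S t)) has_integral Im (integral {0..\<delta> * h} S)) {0..\<delta> * h}"
      using has_integral_linear[OF integrable_integral[OF integrable_continuous_real[OF Sc]] bounded_linear_Im]
      by (simp add: o_def)
    ultimately have "E ^ n * (\<delta>\<^sup>2 * h / 8) \<le> Im (integral {0..\<delta> * h} S)"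
    proof (rule has_integral_le)
      fix t assume "t \<in> {0..\<delta> * h}"
      moreover have "Im (of_real (E ^ n) * x) = E ^ n * Im x" for x
        by (simp del: of_real_power)
      ultimately show "E ^ n * (t / (4 * h)) \<le> Im (S t)"
        unfolding S_def tf using E lower by (simp only:) (intro mult_left_mono, auto)
    qed
    also have "\<dots> \<le> cmod (integral {0..\<delta> * h} S)" using abs_Im_le_cmod abs_le_D1 by blast
    finally show "(h powr ((1 + p) / 2) / h) ^ n * (\<delta>\<^sup>2 * h / 8) \<le>
       cmod (integral {0..\<delta> * h} (\<lambda>t. test_function p h (cis t) ^ n - test_function p h (cis (- t)) ^ n))"
      unfolding E_def S_def .
  qed
qed

section \<open>Vanishing of the Taylor coefficients of order at least two\<close>

lemma affine_of_higher_derivs_zero: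
  assumes \<phi>: "\<phi> holomorphic_on UNIV" and z: "\<And>n. 2 \<le> n \<Longrightarrow> (deriv ^^ n) \<phi> 0 = 0"
  shows "\<phi> z = deriv \<phi> 0 * z + \<phi> 0"
proof -
  have "(\<lambda>n. (deriv ^^ n) \<phi> 0 / fact n * (z - 0) ^ n) sums \<phi> z"
    by (rule holomorphic_power_series[of _ _ "cmod z + 1"]) (use \<phi> in \<open>auto intro: holomorphic_on_subset\<close>)
  moreover have "(\<lambda>n. (deriv ^^ n) \<phi> 0 / fact n * (z - 0) ^ n) sums (\<Sum>n\<in>{0, 1}. (deriv ^^ n) \<phi> 0 / fact n * (z - 0) ^ n)"
  proof (rule sums_finite)
    fix n :: nat assume "n \<notin> {0, 1}"
    then have "2 \<le> n" by auto
    then show "(deriv ^^ n) \<phi> 0 / fact n * (z - 0) ^ n = 0" using z by simp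
  qed auto
  ultimately have "\<phi> z = (\<Sum>n\<in>{0, 1}. (deriv ^^ n) \<phi> 0 / fact n * (z - 0) ^ n)"
    by (rule sums_unique2)
  then show ?thesis by simp
qed

text \<open>Membership of the test functions is checked in the smaller space and the norm estimate
  is used in the larger one; the inclusions \<open>CA0 p \<subseteq> X\<close> and
  \<open>X \<subseteq> CA p\<close> thus treat both choices of \<open>X\<close> together.\<close>

lemma maps_boundedly_imp_affine:
  assumes p: "0 \<le> p" "p < 1" and \<phi>: "\<phi> holomorphic_on UNIV"
    and X: "CA0 p \<subseteq> X" "X \<subseteq> CA p" and bd: "maps_boundedly (CA_norm p) X (superposition \<phi>)"
  shows "\<exists>a b. \<forall>z. \<phi> z = a * z + b"
proof -
  define f where "f h w z = w * test_function p h z" for h w z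
  \<comment> \<open>One family in \<open>h\<close> and \<open>w\<close>, so that boundedness of the
    operator gives a single constant for all its members.\<close>
  define T where "T = {f h w | h w. 0 < h \<and> h \<le> 1 / 2 \<and> cmod w = 1}"
  have hol: "f h w holomorphic_on cball 0 1" if "0 < h" "h \<le> 1 / 2" for h w
    unfolding f_def by (intro holomorphic_intros holomorphic_test_function) (use that in auto)
  have TX: "T \<subseteq> X"
    using CA0_cball[OF hol] X(1) p unfolding T_def by blast
  have "\<forall>g\<in>T. CA_norm p g \<le> 1 + sqrt (2 * pi)"
  proof
    fix g assume "g \<in> T"
    then obtain h w where "g = f h w" "0 < h" "h \<le> 1 / 2" "cmod w = 1" unfolding T_def by blast
    then show "CA_norm p g \<le> 1 + sqrt (2 * pi)"
      using CA_norm_test_function_le[of h w p] p unfolding f_def by auto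
  qed
  moreover have "(\<exists>M. \<forall>g\<in>T. CA_norm p g \<le> M) \<longrightarrow> (\<exists>M. \<forall>g\<in>T. CA_norm p (superposition \<phi> g) \<le> M)"
    using bd[unfolded maps_boundedly_def, THEN conjunct2, rule_format, OF TX] by (rule impI)
  ultimately obtain M0 where M0: "\<And>g. g \<in> T \<Longrightarrow> CA_norm p (superposition \<phi> g) \<le> M0"
    by blast
  \<comment> \<open>The maximum with \<open>1\<close> supplies the positive bound that
    \<open>odd_average_le\<close> asks for.\<close>
  define M where "M = max M0 1"
  have sup: "superposition \<phi> g \<in> CA p" "CA_norm p (superposition \<phi> g) \<le> M" if "g \<in> T" for g
    using bd TX X(2) M0[OF that] that unfolding maps_boundedly_def M_def by auto
  have zero: "(deriv ^^ n) \<phi> 0 = 0" if n: "2 \<le> n" for n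
  proof (rule ccontr)
    assume nz: "(deriv ^^ n) \<phi> 0 \<noteq> 0"
    have n1: "1 \<le> n" using n by simp
    obtain \<delta> where \<delta>: "0 < \<delta>" "\<delta> \<le> 1" and low:
      "\<And>h. 0 < h \<Longrightarrow> h \<le> 1 / 2 \<Longrightarrow> (h powr ((1 + p) / 2) / h) ^ n * (\<delta>\<^sup>2 * h / 8) \<le>
       cmod (integral {0..\<delta> * h} (\<lambda>t. test_function p h (cis t) ^ n - test_function p h (cis (- t)) ^ n))"
      using test_function_power_odd_average[OF n1, of p] by blast
    define c where "c = cmod ((deriv ^^ n) \<phi> 0) * \<delta>\<^sup>2 / 8"
    have c: "0 < c" using nz \<delta> by (simp add: c_def)
    define K where "K = fact n * (2 * M) / c"
    have main: "h powr ((p - 1) / 2) \<le> K" if h: "0 < h" "h \<le> 1 / 2" for h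
    proof -
      define R where "R = h powr ((p - 1) / 2)"
      have tf: "test_function p h holomorphic_on cball 0 1" by (rule holomorphic_test_function) (use h in auto)
      have dh: "0 < \<delta> * h" "\<delta> * h \<le> 1" "\<delta> * h \<le> h"
        using \<delta> h mult_le_one[of \<delta> h] mult_right_le_one_le[of h \<delta>] by (auto simp: mult.commute)
      have "cmod ((deriv ^^ n) \<phi> 0) *
          cmod (integral {0..\<delta> * h} (\<lambda>t. test_function p h (cis t) ^ n - test_function p h (cis (- t)) ^ n))
          \<le> fact n * (2 * M * (\<delta> * h) powr ((1 + p) / 2))"
      proof (rule odd_average_coefficient_bound[OF \<phi>])
        fix w :: complex assume w: "cmod w = 1"
        have T: "f h w \<in> T" unfolding T_def using h w by blast
        have "\<phi> \<circ> f h w holomorphic_on cball 0 1"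
          by (rule holomorphic_on_compose_gen[OF hol[OF h] \<phi>]) auto
        then have "superposition \<phi> (f h w) holomorphic_on cball 0 1"
          by (simp add: superposition_def)
        from odd_average_le[OF this sup[OF T] _ dh(1,2) p]
        show "cmod (integral {0..\<delta> * h} (\<lambda>t. \<phi> (w * test_function p h (cis t)) - \<phi> (w * test_function p h (cis (- t)))))
            \<le> 2 * M * (\<delta> * h) powr ((1 + p) / 2)"
          by (simp add: superposition_def f_def M_def)
      qed (intro continuous_on_cis_of_cball tf continuous_intros
            continuous_on_compose2[OF continuous_on_cis_of_cball[OF tf, of UNIV]]; simp)+
      also have "\<dots> \<le> fact n * (2 * M * h powr ((1 + p) / 2))"
        using dh p by (intro mult_left_mono powr_mono2) (auto simp: M_def)
      finally have up: "cmod ((deriv ^^ n) \<phi> 0) *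
          cmod (integral {0..\<delta> * h} (\<lambda>t. test_function p h (cis t) ^ n - test_function p h (cis (- t)) ^ n))
          \<le> fact n * (2 * M * h powr ((1 + p) / 2))" .
      have "h powr ((1 + p) / 2) / h powr 1 = R"
        unfolding powr_diff[symmetric] R_def by (simp add: field_simps)
      then have R: "h powr ((1 + p) / 2) / h = R" "h powr ((1 + p) / 2) = R * h" using h by (auto simp: field_simps)
      have R1: "1 \<le> R"
        unfolding R_def using powr_mono2'[of "(p - 1) / 2" h 1] h p by simp
      have "cmod ((deriv ^^ n) \<phi> 0) * (R ^ n * (\<delta>\<^sup>2 * h / 8)) \<le> fact n * (2 * M * (R * h))"
        using order_trans[OF mult_left_mono[OF low[OF h]] up] h(1) unfolding R by simp
      then have "(c * R ^ n) * h \<le> (fact n * (2 * M) * R) * h" by (simp add: c_def mult_ac)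
      then have "c * R ^ n \<le> fact n * (2 * M) * R" using h by simp
      \<comment> \<open>Here \<open>2 \<le> n\<close> enters, together with
        \<open>1 \<le> R\<close>: cancelling one \<open>R\<close> against the right-hand side leaves
        \<open>R\<close> bounded uniformly in \<open>h\<close>.\<close>
      moreover have "R * R \<le> R ^ n"
        using power_increasing[OF n R1] by (simp add: power2_eq_square)
      then have "c * (R * R) \<le> c * R ^ n" using c by simp
      ultimately have "(c * R) * R \<le> (fact n * (2 * M)) * R" by (simp add: mult_ac)
      then have "c * R \<le> fact n * (2 * M)" using R1 by simp
      then show ?thesis unfolding K_def R_def[symmetric] using c by (simp add: field_simps)
    qed
    have K: "0 < K" using c by (simp add: K_def M_def)
    \<comment> \<open>The exponent \<open>2 / (p - 1)\<close> inverts \<open>(p - 1) / 2\<close>,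
      which is negative; so this small \<open>h\<close> forces \<open>h powr ((p - 1) / 2)\<close>
      to be at least \<open>2 * K\<close>.\<close>
    define h where "h = min (1 / 2) ((2 * K) powr (2 / (p - 1)))"
    have h: "0 < h" "h \<le> 1 / 2" using K by (auto simp: h_def)
    have "2 * K = ((2 * K) powr (2 / (p - 1))) powr ((p - 1) / 2)"
    proof -
      have "2 / (p - 1) * ((p - 1) / 2) = 1" using p by simp
      then have "((2 * K) powr (2 / (p - 1))) powr ((p - 1) / 2) = (2 * K) powr 1"
        by (simp only: powr_powr)
      then show ?thesis using K by simp
    qed
    also have "\<dots> \<le> h powr ((p - 1) / 2)"
      using h p by (intro powr_mono2') (auto simp: h_def)
    also have "\<dots> \<le> K" by (rule main[OF h])
    finally show False using K by simp
  qed
  then show ?thesis using affine_of_higher_derivs_zero[OF \<phi>] by blast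
qed

theorem theorem3p1:
  fixes p :: real and \<phi> :: "complex \<Rightarrow> complex" and X :: "(complex \<Rightarrow> complex) set"
  assumes "0 \<le> p" and "p < 1"
    and "\<phi> holomorphic_on UNIV"
    and "X = CA p \<or> X = CA0 p"
  shows "maps_boundedly (CA_norm p) X (superposition \<phi>) \<longleftrightarrow>
    (\<exists>a b. \<forall>z. \<phi> z = a * z + b)"
proof
  assume "maps_boundedly (CA_norm p) X (superposition \<phi>)"
  moreover have "CA0 p \<subseteq> X" "X \<subseteq> CA p" using assms(4) by (auto simp: CA0_def)
  ultimately show "\<exists>a b. \<forall>z. \<phi> z = a * z + b"
    using maps_boundedly_imp_affine assms by blast
next
  assume "\<exists>a b. \<forall>z. \<phi> z = a * z + b"
  then show "maps_boundedly (CA_norm p) X (superposition \<phi>)"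
    using affine_maps_boundedly[OF assms(4)] by blast
qed

end
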